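(* Let $(W,S)$ be a Coxeter system of finite rank. The following two conditions are equivalent. (1) For every $S'\subset S$ and all $Q,J,K\subset S'$, the series $p^{S'}_{Q,J,K}(t)$ is a rational function. (2) For every $S'\subset S$ and all $L,M\subset S'$ with $W_L$ finite, the Poincaré series of the set $\{x\in W_{S'}\mid xLx^{-1}=M\}$ is a rational function.
   Context: $(W,S)$ is a Coxeter system with $S$ finite and $\ell$ is its length function. The symbol $\subset$ allows equality. For $X\subset W$ the Poincaré series of $X$ is $X(t)=\sum_{x\in X}t^{\ell(x)}\in\mathbb{Z}[[t]]$; it is called a rational function if it is the power series expansion of an element of $\mathbb{Q}(t)$. For $J\subset S$, $W_J$ is the subgroup generated by $J$. For $J,K\subset S'\subset S$, let ${}^JW_{S'}=\{w\in W_{S'}\mid \ell(sw)>\ell(w)\ \forall s\in J\}$, $W_{S'}^K=\{w\in W_{S'}\mid \ell(ws)>\ell(w)\ \forall s\in K\}$ and ${}^JW_{S'}^K={}^JW_{S'}\cap W_{S'}^K$. For $Q,J,K\subset S'\subset S$, define $p^{S'}_{Q,J,K}=\{x\in{}^JW_{S'}^K\mid K\cap x^{-1}Jx=Q\}$. *)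

theory Defs
  imports "HOL-Algebra.Generated_Groups" "HOL-Algebra.Multiplicative_Group" "HOL-Computational_Algebra.Computational_Algebra"
begin

(* A letter (True, s) stands for the generator s and (False, s) for its formal inverse. *)
type_synonym 'a gword = "(bool \<times> 'a) list"

definition letter_value :: "('a, 'b) monoid_scheme \<Rightarrow> bool \<times> 'a \<Rightarrow> 'a" where
  "letter_value G a = (if fst a then snd a else inv\<^bsub>G\<^esub> snd a)"

definition gword_value :: "('a, 'b) monoid_scheme \<Rightarrow> 'a gword \<Rightarrow> 'a" where
  "gword_value G w = foldr (\<lambda>a x. letter_value G a \<otimes>\<^bsub>G\<^esub> x) w \<one>\<^bsub>G\<^esub>"

(* Equality of two words over A in the abstract group with generators A and relators R,
   i.e. in the free group on A modulo the normal closure of R. *)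
inductive presented_eq :: "'a set \<Rightarrow> 'a gword set \<Rightarrow> 'a gword \<Rightarrow> 'a gword \<Rightarrow> bool"
  for A :: "'a set" and R :: "'a gword set" where
  refl: "w \<in> lists (UNIV \<times> A) \<Longrightarrow> presented_eq A R w w"
| sym: "presented_eq A R v w \<Longrightarrow> presented_eq A R w v"
| trans: "presented_eq A R u v \<Longrightarrow> presented_eq A R v w \<Longrightarrow> presented_eq A R u w"
| cancel: "u \<in> lists (UNIV \<times> A) \<Longrightarrow> v \<in> lists (UNIV \<times> A) \<Longrightarrow> x \<in> A \<Longrightarrow>
    presented_eq A R (u @ [(b, x), (\<not> b, x)] @ v) (u @ v)"
| relator: "u \<in> lists (UNIV \<times> A) \<Longrightarrow> v \<in> lists (UNIV \<times> A) \<Longrightarrow> r \<in> R \<Longrightarrow>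
    presented_eq A R (u @ r @ v) (u @ v)"

definition has_presentation ::
  "('a, 'b) monoid_scheme \<Rightarrow> 'a set \<Rightarrow> 'a gword set \<Rightarrow> bool" where
  "has_presentation G A R \<longleftrightarrow>
     group G \<and> A \<subseteq> carrier G \<and> R \<subseteq> lists (UNIV \<times> A) \<and> generate G A = carrier G \<and>
     (\<forall>v \<in> lists (UNIV \<times> A). \<forall>w \<in> lists (UNIV \<times> A).
        gword_value G v = gword_value G w \<longleftrightarrow> presented_eq A R v w)"

(* The relators (s t)^m(s,t), where m(s,t) is the order of s t in W. The library's group.ord
   is 0 on elements of infinite order; such pairs contribute no relator. *)
definition coxeter_relators :: "('a, 'b) monoid_scheme \<Rightarrow> 'a set \<Rightarrow> 'a gword set" where
  "coxeter_relators W S =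
     {concat (replicate (group.ord W (s \<otimes>\<^bsub>W\<^esub> t)) [(True, s), (True, t)]) | s t.
        s \<in> S \<and> t \<in> S \<and> group.ord W (s \<otimes>\<^bsub>W\<^esub> t) \<noteq> 0}"

definition coxeter_system :: "('a, 'b) monoid_scheme \<Rightarrow> 'a set \<Rightarrow> bool" where
  "coxeter_system W S \<longleftrightarrow>
     group W \<and> S \<subseteq> carrier W \<and> (\<forall>s\<in>S. group.ord W s = 2) \<and>
     has_presentation W S (coxeter_relators W S)"

definition cox_length :: "('a, 'b) monoid_scheme \<Rightarrow> 'a set \<Rightarrow> 'a \<Rightarrow> nat" where
  "cox_length W S w =
     (LEAST n. \<exists>ss \<in> lists S. length ss = n \<and> foldr (\<lambda>s x. s \<otimes>\<^bsub>W\<^esub> x) ss \<one>\<^bsub>W\<^esub> = w)"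

(* For finite S and A contained in W, only finitely many elements of A have a given length. *)
definition poincare_series :: "('a, 'b) monoid_scheme \<Rightarrow> 'a set \<Rightarrow> 'a set \<Rightarrow> int fps" where
  "poincare_series W S A = Abs_fps (\<lambda>n. int (card {x \<in> A. cox_length W S x = n}))"

(* An element of Q(t) has a power series expansion at 0 iff it can be written p / q with
   q(0) nonzero; q is then a unit in Q[[t]] and the quotient below is the expansion. *)
definition rational_series :: "int fps \<Rightarrow> bool" where
  "rational_series F \<longleftrightarrow>
     (\<exists>p q :: rat poly. coeff q 0 \<noteq> 0 \<and>
        Abs_fps (\<lambda>n. of_int (fps_nth F n)) = fps_of_poly p / fps_of_poly q)"

definition left_min_reps :: "('a, 'b) monoid_scheme \<Rightarrow> 'a set \<Rightarrow> 'a set \<Rightarrow> 'a set \<Rightarrow> 'a set" where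
  "left_min_reps W S S' J =
     {w \<in> generate W S'. \<forall>s\<in>J. cox_length W S (s \<otimes>\<^bsub>W\<^esub> w) > cox_length W S w}"

definition right_min_reps :: "('a, 'b) monoid_scheme \<Rightarrow> 'a set \<Rightarrow> 'a set \<Rightarrow> 'a set \<Rightarrow> 'a set" where
  "right_min_reps W S S' K =
     {w \<in> generate W S'. \<forall>s\<in>K. cox_length W S (w \<otimes>\<^bsub>W\<^esub> s) > cox_length W S w}"

definition double_min_reps ::
  "('a, 'b) monoid_scheme \<Rightarrow> 'a set \<Rightarrow> 'a set \<Rightarrow> 'a set \<Rightarrow> 'a set \<Rightarrow> 'a set" where
  "double_min_reps W S S' J K = left_min_reps W S S' J \<inter> right_min_reps W S S' K"

definition p_set ::
  "('a, 'b) monoid_scheme \<Rightarrow> 'a set \<Rightarrow> 'a set \<Rightarrow> 'a set \<Rightarrow> 'a set \<Rightarrow> 'a set \<Rightarrow> 'a set" where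
  "p_set W S S' Q J K =
     {x \<in> double_min_reps W S S' J K.
        K \<inter> (\<lambda>s. inv\<^bsub>W\<^esub> x \<otimes>\<^bsub>W\<^esub> s \<otimes>\<^bsub>W\<^esub> x) ` J = Q}"

end

theory Submission
  imports Defs
begin

text \<open>
  Both conditions hold for every Coxeter system of finite rank: the series
  \<open>p\<^sup>S\<^sup>'\<^sub>Q\<^sub>,\<^sub>J\<^sub>,\<^sub>K(t)\<close> are always rational, and the series in the second condition are products of such
  series with polynomials.

  The rationality proof generalises the classical recursion
  \<open>\<Sum>\<^sub>K (-1)\<^bsup>|K|\<^esup> W(t) / W\<^sub>K(t) = t\<^bsup>\<ell>(w)\<^esup>\<close> or \<open>0\<close> for the Poincare series of \<open>W\<close> itself, where
  \<open>w\<close> is the longest element if \<open>W\<close> is finite, and the value is \<open>0\<close> otherwise. For \<open>Q \<subseteq> K \<subseteq> S'\<close>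
  let \<open>F(K, Q)\<close> be the series of those \<open>x\<close> in \<open>\<^sup>JW\<^sub>S\<^sub>'\<^sup>K\<close> for which \<open>x Q x\<inverse> \<subseteq> J\<close> (\<open>conj_reps\<close>). It is the sum
  of \<open>p\<^sup>S\<^sup>'\<^sub>Q\<^sub>'\<^sub>,\<^sub>J\<^sub>,\<^sub>K\<close> over \<open>Q \<subseteq> Q' \<subseteq> K\<close>. Two relations determine these series by induction on \<open>S'\<close>.

  First, the factorisation \<open>x = y z\<close> with \<open>y\<close> minimal in \<open>x W\<^sub>K\<close> and \<open>z \<in> W\<^sub>K\<close> gives
  \<open>F(Q, Q) = \<Sum>\<^sub>Q\<^sub>' p\<^sup>S\<^sup>'\<^sub>Q\<^sub>'\<^sub>,\<^sub>J\<^sub>,\<^sub>K p\<^sup>K\<^sub>Q\<^sub>,\<^sub>Q\<^sub>'\<^sub>,\<^sub>Q\<close> for every \<open>K\<close> (\<open>conj_reps_factor\<close>). For \<open>K \<noteq> S'\<close> the second factors are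
  rational by induction and have constant term \<open>1\<close> if \<open>Q \<subseteq> Q'\<close> and \<open>0\<close> otherwise; hence \<open>F(K, Q)\<close> and
  \<open>F(Q, Q)\<close> differ by a combination of the series \<open>p\<^sup>S\<^sup>'\<^sub>Q\<^sub>'\<^sub>,\<^sub>J\<^sub>,\<^sub>K\<close> whose coefficients are rational and vanish
  at \<open>t = 0\<close>.

  Second, by inclusion and exclusion \<open>\<Sum>\<^sub>K (-1)\<^bsup>|K - Q|\<^esup> F(K, Q)\<close> is the series of those \<open>x\<close>
  counted by \<open>F(Q, Q)\<close> whose right ascents in \<open>S'\<close> are exactly \<open>Q\<close>. This set is finite (\<open>finite_all_descents\<close>): such an \<open>x\<close> behaves like the
  longest element of \<open>W\<^sub>S\<^sub>'\<^sup>Q\<close>, and its length bounds all of \<open>W\<^sub>S\<^sub>'\<^sup>Q\<close>. The term with \<open>K = S'\<close>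
  is constant, and for \<open>Q \<noteq> S'\<close> the signs of the terms with
  \<open>K \<noteq> S'\<close> add up to \<open>\<plusminus>1\<close>, so \<open>F(Q, Q)\<close>, and with it every \<open>p\<^sup>S\<^sup>'\<^sub>Q\<^sub>,\<^sub>J\<^sub>,\<^sub>K\<close> with \<open>K \<noteq> S'\<close>, is a rational series plus
  a combination of the \<open>p\<close>'s with coefficients vanishing at \<open>t = 0\<close>. A Nakayama argument in the local
  ring of rational series then shows that all of them are rational (\<open>rational_of_small_combinations\<close>).

  For the second condition, \<open>|L| = |M|\<close> may be assumed, as the set is empty otherwise. Write \<open>x\<close> with \<open>x L x\<inverse> = M\<close> as \<open>y u\<close> with \<open>y\<close> minimal in \<open>x W\<^sub>L\<close> and \<open>u \<in> W\<^sub>L\<close>. Then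
  \<open>u\<close> normalises \<open>L\<close> and \<open>y\<close> ranges over \<open>p\<^sup>S\<^sup>'\<^sub>L\<^sub>,\<^sub>M\<^sub>,\<^sub>L\<close>, so the series is the product of \<open>p\<^sup>S\<^sup>'\<^sub>L\<^sub>,\<^sub>M\<^sub>,\<^sub>L(t)\<close> and the
  polynomial of a subset of the finite group \<open>W\<^sub>L\<close>.

  The facts about \<open>W\<close> used here rest on the exchange condition, which is derived from the presentation
  by counting reflections modulo \<open>2\<close>, and on the additivity of length along parabolic cosets.
\<close>

section \<open>Rational power series\<close>

definition rational_fps :: "rat fps set" where
  "rational_fps = {F. \<exists>p q. coeff q 0 \<noteq> 0 \<and> F = fps_of_poly p / fps_of_poly q}"

text \<open>Clearing the denominator turns the closure properties below into identities between polynomials.\<close>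

lemma rational_fps_iff:
  "F \<in> rational_fps \<longleftrightarrow> (\<exists>p q. coeff q 0 \<noteq> 0 \<and> F * fps_of_poly q = fps_of_poly p)"
proof -
  have "F = fps_of_poly p / fps_of_poly q \<longleftrightarrow> F * fps_of_poly q = fps_of_poly p"
    if "coeff q 0 \<noteq> 0" for p q
  proof -
    have u: "inverse (fps_of_poly q) * fps_of_poly q = 1" "fps_nth (fps_of_poly q) 0 \<noteq> 0"
      using that by (simp_all add: inverse_mult_eq_1)
    then have "F = fps_of_poly p / fps_of_poly q \<longleftrightarrow> F = fps_of_poly p * inverse (fps_of_poly q)"
      by (simp add: fps_divide_unit)
    also have "\<dots> \<longleftrightarrow> F * fps_of_poly q = fps_of_poly p"
    proof
      assume F: "F = fps_of_poly p * inverse (fps_of_poly q)"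
      have "F * fps_of_poly q = fps_of_poly p * (inverse (fps_of_poly q) * fps_of_poly q)"
        unfolding F by (simp only: mult.assoc)
      then show "F * fps_of_poly q = fps_of_poly p" unfolding u(1) by simp
    next
      assume F: "F * fps_of_poly q = fps_of_poly p"
      have "fps_of_poly p * inverse (fps_of_poly q) = F * (inverse (fps_of_poly q) * fps_of_poly q)"
        unfolding F[symmetric] by (simp only: mult.assoc mult.commute[of "fps_of_poly q"])
      then show "F = fps_of_poly p * inverse (fps_of_poly q)" unfolding u(1) by simp
    qed
    finally show ?thesis .
  qed
  then show ?thesis unfolding rational_fps_def by blast
qed

lemma rational_fps_poly: "fps_of_poly p \<in> rational_fps"
  unfolding rational_fps_iff by (intro exI[of _ p] exI[of _ 1]) simp

lemma rational_fps_0 [simp]: "0 \<in> rational_fps"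
  using rational_fps_poly[of 0] by simp

lemma rational_fps_1 [simp]: "1 \<in> rational_fps"
  using rational_fps_poly[of 1] by simp

lemma rational_fps_mult [intro]:
  assumes "F \<in> rational_fps" "G \<in> rational_fps"
  shows "F * G \<in> rational_fps"
proof -
  obtain p q p' q' where *: "coeff q 0 \<noteq> 0" "F * fps_of_poly q = fps_of_poly p"
    "coeff q' 0 \<noteq> 0" "G * fps_of_poly q' = fps_of_poly p'"
    using assms unfolding rational_fps_iff by blast
  have "F * G * fps_of_poly (q * q') = fps_of_poly (p * p')"
    unfolding fps_of_poly_mult *(2,4)[symmetric] by (simp add: mult_ac)
  moreover have "coeff (q * q') 0 \<noteq> 0" using * by (simp add: coeff_mult_0)
  ultimately show ?thesis unfolding rational_fps_iff by blast
qed

lemma rational_fps_add [intro]: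
  assumes "F \<in> rational_fps" "G \<in> rational_fps"
  shows "F + G \<in> rational_fps"
proof -
  obtain p q p' q' where *: "coeff q 0 \<noteq> 0" "F * fps_of_poly q = fps_of_poly p"
    "coeff q' 0 \<noteq> 0" "G * fps_of_poly q' = fps_of_poly p'"
    using assms unfolding rational_fps_iff by blast
  have "(F + G) * fps_of_poly (q * q') = fps_of_poly (p * q' + p' * q)"
    unfolding fps_of_poly_mult fps_of_poly_add *(2,4)[symmetric] by (simp add: algebra_simps)
  moreover have "coeff (q * q') 0 \<noteq> 0" using * by (simp add: coeff_mult_0)
  ultimately show ?thesis unfolding rational_fps_iff by blast
qed

lemma rational_fps_uminus: "F \<in> rational_fps \<Longrightarrow> - F \<in> rational_fps"
  using rational_fps_mult[OF rational_fps_poly[of "-1"], of F] by (simp add: fps_of_poly_uminus)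

lemma rational_fps_diff: "F \<in> rational_fps \<Longrightarrow> G \<in> rational_fps \<Longrightarrow> F - G \<in> rational_fps"
  using rational_fps_add[OF _ rational_fps_uminus, of F G] by simp

lemma rational_fps_inverse:
  assumes "F \<in> rational_fps" "fps_nth F 0 \<noteq> 0"
  shows "inverse F \<in> rational_fps"
proof -
  obtain p q where *: "coeff q 0 \<noteq> 0" "F * fps_of_poly q = fps_of_poly p"
    using assms unfolding rational_fps_iff by blast
  have "inverse F * fps_of_poly p = fps_of_poly q"
    unfolding *(2)[symmetric] using assms(2) by (simp add: inverse_mult_eq_1 mult.assoc[symmetric])
  moreover have "fps_nth F 0 * coeff q 0 = coeff p 0"
    using arg_cong[OF *(2), of "\<lambda>F. fps_nth F 0"] by simp
  then have "coeff p 0 \<noteq> 0" using *(1) assms(2) by auto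
  ultimately show ?thesis unfolding rational_fps_iff by blast
qed

lemma rational_fps_sum: "(\<And>i. i \<in> I \<Longrightarrow> F i \<in> rational_fps) \<Longrightarrow> (\<Sum>i\<in>I. F i) \<in> rational_fps"
  by (induction I rule: infinite_finite_induct) auto

text \<open>The submodule \<open>R + \<Sum>\<^sub>j \<mm> v\<^sub>j\<close>, where \<open>R\<close> is the local ring of rational series and \<open>\<mm>\<close> its
  maximal ideal, the rational series that vanish at \<open>0\<close>. Membership is the way in which identities are used
  modulo small error terms.\<close>

definition small_combinations :: "'i set \<Rightarrow> ('i \<Rightarrow> rat fps) \<Rightarrow> rat fps set" where
  "small_combinations I v = {r + (\<Sum>j\<in>I. c j * v j) | r c.
     r \<in> rational_fps \<and> (\<forall>j\<in>I. c j \<in> rational_fps \<and> fps_nth (c j) 0 = 0)}"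

lemma small_combinationsI:
  assumes "r \<in> rational_fps" "\<And>j. j \<in> I \<Longrightarrow> c j \<in> rational_fps \<and> fps_nth (c j) 0 = 0"
    "F = r + (\<Sum>j\<in>I. c j * v j)"
  shows "F \<in> small_combinations I v"
  using assms unfolding small_combinations_def by blast

lemma rational_small_combination: "r \<in> rational_fps \<Longrightarrow> r \<in> small_combinations I v"
  by (rule small_combinationsI[of r I "\<lambda>_. 0"]) auto

lemma small_multiple_small_combination:
  assumes "finite I" "i \<in> I" "c \<in> rational_fps" "fps_nth c 0 = 0"
  shows "c * v i \<in> small_combinations I v"
proof (rule small_combinationsI[of 0 I "\<lambda>j. if j = i then c else 0"])
  show "c * v i = 0 + (\<Sum>j\<in>I. (if j = i then c else 0) * v j)"
    using assms by (simp add: if_distrib[of "\<lambda>x. x * _"] cong: if_cong)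
qed (use assms in auto)

lemma small_combinations_add:
  assumes "F \<in> small_combinations I v" "G \<in> small_combinations I v"
  shows "F + G \<in> small_combinations I v"
proof -
  obtain r c where 1: "r \<in> rational_fps" "\<And>j. j \<in> I \<Longrightarrow> c j \<in> rational_fps \<and> fps_nth (c j) 0 = 0"
    "F = r + (\<Sum>j\<in>I. c j * v j)"
    using assms(1) unfolding small_combinations_def by blast
  obtain r' c' where 2: "r' \<in> rational_fps" "\<And>j. j \<in> I \<Longrightarrow> c' j \<in> rational_fps \<and> fps_nth (c' j) 0 = 0"
    "G = r' + (\<Sum>j\<in>I. c' j * v j)"
    using assms(2) unfolding small_combinations_def by blast
  show ?thesis
    by (rule small_combinationsI[of "r + r'" I "\<lambda>j. c j + c' j"])
       (use 1 2 in \<open>auto simp: algebra_simps sum.distrib\<close>)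
qed

lemma small_combinations_scale:
  assumes "a \<in> rational_fps" "F \<in> small_combinations I v"
  shows "a * F \<in> small_combinations I v"
proof -
  obtain r c where 1: "r \<in> rational_fps" "\<And>j. j \<in> I \<Longrightarrow> c j \<in> rational_fps \<and> fps_nth (c j) 0 = 0"
    "F = r + (\<Sum>j\<in>I. c j * v j)"
    using assms(2) unfolding small_combinations_def by blast
  show ?thesis
    by (rule small_combinationsI[of "a * r" I "\<lambda>j. a * c j"])
       (use 1 assms(1) in \<open>auto simp: algebra_simps sum_distrib_left\<close>)
qed

lemma small_combinations_diff:
  assumes "F \<in> small_combinations I v" "G \<in> small_combinations I v"
  shows "F - G \<in> small_combinations I v"
  using small_combinations_add[OF assms(1) small_combinations_scale[OF rational_fps_uminus[OF rational_fps_1] assms(2)]]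
  by simp

lemma small_combinations_sum:
  "(\<And>x. x \<in> X \<Longrightarrow> F x \<in> small_combinations I v) \<Longrightarrow> (\<Sum>x\<in>X. F x) \<in> small_combinations I v"
  by (induction X rule: infinite_finite_induct)
     (auto intro: small_combinations_add rational_small_combination)

text \<open>Nakayama's lemma for the module that \<open>R\<close> and the \<open>v\<^sub>j\<close> generate, modulo \<open>R\<close>. One equation is solved
  for its own unknown \<open>v\<^sub>k\<close>, since \<open>1 - c\<^sub>k\<close> has constant term \<open>1\<close> and is invertible; substituting the
  result into the other equations keeps their coefficients in \<open>\<mm>\<close>.\<close>

lemma rational_of_small_combinations:
  assumes "finite I" "\<And>i. i \<in> I \<Longrightarrow> v i \<in> small_combinations I v" "i \<in> I"
  shows "v i \<in> rational_fps"
  using assms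
proof (induction I arbitrary: i rule: finite_induct)
  case (insert k I)
  obtain r c where rc: "r \<in> rational_fps"
    "\<And>j. j \<in> insert k I \<Longrightarrow> c j \<in> rational_fps \<and> fps_nth (c j) 0 = 0"
    "v k = r + (\<Sum>j\<in>insert k I. c j * v j)"
    using insert.prems(1)[of k] unfolding small_combinations_def by blast
  let ?u = "inverse (1 - c k)"
  have "(1 - c k) * v k = r + (\<Sum>j\<in>I. c j * v j)"
    using rc(3) insert.hyps by (simp add: algebra_simps)
  moreover have u: "?u * (1 - c k) = 1" using rc(2)[of k] by (simp add: inverse_mult_eq_1)
  ultimately have "v k = ?u * (r + (\<Sum>j\<in>I. c j * v j))"
    by (metis mult.assoc mult_1)
  then have vk: "v k = ?u * r + (\<Sum>j\<in>I. ?u * c j * v j)"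
    by (simp add: distrib_left sum_distrib_left mult.assoc)
  have ur: "?u \<in> rational_fps"
    using rc(2)[of k] by (intro rational_fps_inverse rational_fps_diff) auto
  have vk_small: "v k \<in> small_combinations I v"
    by (rule small_combinationsI[OF _ _ vk]) (use rc ur in auto)
  have *: "v j \<in> rational_fps" if "j \<in> I" for j
  proof (rule insert.IH[OF _ that])
    fix i assume "i \<in> I"
    obtain r' c' where rc': "r' \<in> rational_fps"
      "\<And>j. j \<in> insert k I \<Longrightarrow> c' j \<in> rational_fps \<and> fps_nth (c' j) 0 = 0"
      "v i = r' + (\<Sum>j\<in>insert k I. c' j * v j)"
      using insert.prems(1)[of i] \<open>i \<in> I\<close> unfolding small_combinations_def by blast
    have "r' + (\<Sum>j\<in>I. c' j * v j) \<in> small_combinations I v"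
      by (rule small_combinationsI[of r' I c']) (use rc' in auto)
    moreover have "c' k * v k \<in> small_combinations I v"
      using rc'(2)[of k] vk_small by (intro small_combinations_scale) auto
    ultimately have "r' + (\<Sum>j\<in>I. c' j * v j) + c' k * v k \<in> small_combinations I v"
      by (rule small_combinations_add)
    then show "v i \<in> small_combinations I v"
      using rc'(3) insert.hyps by (simp add: algebra_simps)
  qed
  moreover have "v k \<in> rational_fps"
    unfolding vk using rc ur * by (intro rational_fps_add rational_fps_mult rational_fps_sum) auto
  ultimately show ?case using insert.prems(2) by blast
qed simp

text \<open>Expanding the product \<open>\<Prod>(- 1 + 1)\<close> over \<open>A - B\<close> gives the sum over all subsets.\<close>

lemma sum_subsets_between_sign:
  assumes "finite A" "B \<subseteq> A"
  shows "(\<Sum>K | B \<subseteq> K \<and> K \<subseteq> A. (- 1) ^ card (K - B)) = (of_bool (A = B) :: 'a :: comm_ring_1)"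
proof -
  have fin: "finite (A - B)" using assms by simp
  have "(\<Sum>K | B \<subseteq> K \<and> K \<subseteq> A. (- 1) ^ card (K - B)) = (\<Sum>X\<in>Pow (A - B). (- 1 :: 'a) ^ card X)"
    by (rule sum.reindex_bij_witness[of _ "\<lambda>X. X \<union> B" "\<lambda>K. K - B"])
       (use assms in \<open>auto intro: arg_cong[of _ _ "\<lambda>X. (- 1) ^ card X"]\<close>)
  also have "\<dots> = (\<Prod>x\<in>A - B. - 1 + 1)"
    unfolding prod_add[OF fin] by simp
  also have "\<dots> = of_bool (A = B)" 
    using assms fin by (auto simp: prod_zero_iff power_0_left)
  finally show ?thesis .
qed

section \<open>The exchange condition\<close>

locale coxeter = group W for W (structure) +
  fixes S :: "'a set"
  assumes cs: "coxeter_system W S"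
begin

abbreviation len :: "'a \<Rightarrow> nat" where "len \<equiv> cox_length W S"

definition val :: "'a list \<Rightarrow> 'a" where
  "val ws = foldr (\<lambda>s x. s \<otimes> x) ws \<one>"

lemma val_simps [simp]: "val [] = \<one>" "val (s # ws) = s \<otimes> val ws"
  by (simp_all add: val_def)

lemma S_carrier: "S \<subseteq> carrier W"
  using cs by (simp add: coxeter_system_def)

lemma gen_carrier [simp, intro]: "s \<in> S \<Longrightarrow> s \<in> carrier W"
  using S_carrier by blast

lemma gen_involution [simp]:
  assumes "s \<in> S"
  shows "s \<otimes> s = \<one>"
proof -
  have "ord s = 2" using assms cs by (simp add: coxeter_system_def)
  moreover have "s [^] ord s = \<one>" using assms by (intro pow_ord_eq_1) auto
  ultimately show ?thesis using assms by (simp add: numeral_2_eq_2)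
qed

lemma gen_not_one: "s \<in> S \<Longrightarrow> s \<noteq> \<one>"
  using cs ord_eq_1[of \<one>] by (force simp: coxeter_system_def)

lemma gen_inv [simp]: "s \<in> S \<Longrightarrow> inv s = s"
  by (simp add: inv_equality)

lemma gen_cancel [simp]: "s \<in> S \<Longrightarrow> x \<in> carrier W \<Longrightarrow> s \<otimes> (s \<otimes> x) = x"
  by (simp add: m_assoc[symmetric])

lemma gen_cancel_right [simp]: "s \<in> S \<Longrightarrow> x \<in> carrier W \<Longrightarrow> x \<otimes> s \<otimes> s = x"
  by (simp add: m_assoc)

lemma mult_left_eq_iff:
  "x \<in> carrier W \<Longrightarrow> y \<in> carrier W \<Longrightarrow> g \<in> carrier W \<Longrightarrow> g \<otimes> x = g \<otimes> y \<longleftrightarrow> x = y"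
  by (metis inv_solve_left m_closed)

lemma mult_right_eq_iff:
  "x \<in> carrier W \<Longrightarrow> y \<in> carrier W \<Longrightarrow> g \<in> carrier W \<Longrightarrow> x \<otimes> g = y \<otimes> g \<longleftrightarrow> x = y"
  by (metis inv_solve_right m_closed)

lemma inv_mult_cancel [simp]:
  "x \<in> carrier W \<Longrightarrow> y \<in> carrier W \<Longrightarrow> inv x \<otimes> (x \<otimes> y) = y"
  "x \<in> carrier W \<Longrightarrow> y \<in> carrier W \<Longrightarrow> x \<otimes> (inv x \<otimes> y) = y"
  by (simp_all add: m_assoc[symmetric])

lemma val_carrier [simp]: "ws \<in> lists (carrier W) \<Longrightarrow> val ws \<in> carrier W"
  by (induction ws) auto

lemma lists_S_carrier: "ws \<in> lists S \<Longrightarrow> ws \<in> lists (carrier W)"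
  by auto

lemma val_S [simp]: "ws \<in> lists S \<Longrightarrow> val ws \<in> carrier W"
  by (rule val_carrier[OF lists_S_carrier])

lemma val_append:
  "us \<in> lists (carrier W) \<Longrightarrow> vs \<in> lists (carrier W) \<Longrightarrow> val (us @ vs) = val us \<otimes> val vs"
  by (induction us) (auto simp: m_assoc)

lemma val_append_S [simp]:
  "us \<in> lists S \<Longrightarrow> vs \<in> lists S \<Longrightarrow> val (us @ vs) = val us \<otimes> val vs"
  by (rule val_append) auto

lemma rev_lists [simp]: "rev ws \<in> lists A \<longleftrightarrow> ws \<in> lists A"
  by (simp add: in_lists_conv_set)

lemma val_rev: "ws \<in> lists S \<Longrightarrow> val (rev ws) = inv (val ws)"
proof (induction ws)
  case (Cons s ws)
  then show ?case
    by (simp add: inv_mult_group)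
qed simp

lemma lists_subset: "ws \<in> lists K \<Longrightarrow> K \<subseteq> S \<Longrightarrow> ws \<in> lists S"
  by auto

lemma generate_eq_val:
  assumes "K \<subseteq> S"
  shows "generate W K = val ` lists K"
proof
  show "generate W K \<subseteq> val ` lists K"
  proof
    fix x assume "x \<in> generate W K"
    then show "x \<in> val ` lists K"
    proof induction
      case one
      have "val [] = \<one>" by simp
      then show ?case by (metis imageI lists.Nil)
    next
      case (incl h)
      then have "h = val [h]" using assms by auto
      then show ?case using incl by (metis imageI lists.Cons lists.Nil)
    next
      case (inv h)
      then have "inv h = val [h]" using assms by auto
      then show ?case using inv by (metis imageI lists.Cons lists.Nil)
    next
      case (eng h1 h2)
      then obtain a b where "a \<in> lists K" "b \<in> lists K" "h1 = val a" "h2 = val b" by blast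
      then have "h1 \<otimes> h2 = val (a @ b)" using assms by (metis lists_subset val_append_S)
      then show ?case using \<open>a \<in> lists K\<close> \<open>b \<in> lists K\<close> by (metis append_in_lists_conv imageI)
    qed
  qed
  show "val ` lists K \<subseteq> generate W K"
  proof -
    have "val ws \<in> generate W K" if "ws \<in> lists K" for ws
      using that by (induction ws) (auto intro: generate.one generate.eng generate.incl)
    then show ?thesis by blast
  qed
qed

lemma generate_S: "generate W S = carrier W"
  using cs by (simp add: coxeter_system_def has_presentation_def)

lemma generate_carrier: "K \<subseteq> S \<Longrightarrow> x \<in> generate W K \<Longrightarrow> x \<in> carrier W"
  using generate_in_carrier[of K x] by auto

lemma obtain_word:
  assumes "x \<in> carrier W"
  obtains ws where "ws \<in> lists S" "val ws = x"
proof -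
  have "x \<in> val ` lists S" using assms generate_S generate_eq_val[of S] by simp
  then show ?thesis using that by blast
qed

text \<open>For a word \<open>s\<^sub>1 \<dots> s\<^sub>n\<close> this counts the positions \<open>i\<close> at which the reflection
  \<open>s\<^sub>1 \<dots> s\<^sub>i \<dots> s\<^sub>1\<close> equals \<open>r\<close>. Multiplying by \<open>r\<close> on the left deletes the letter at such a position.\<close>

fun refl_count :: "'a list \<Rightarrow> 'a \<Rightarrow> nat" where
  "refl_count [] r = 0"
| "refl_count (s # ws) r = of_bool (r = s) + refl_count ws (s \<otimes> r \<otimes> s)"

lemma refl_count_append:
  assumes "us \<in> lists S" "r \<in> carrier W"
  shows "refl_count (us @ vs) r = refl_count us r + refl_count vs (inv (val us) \<otimes> r \<otimes> val us)"
  using assms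
proof (induction us arbitrary: r)
  case (Cons s us)
  then have "refl_count (us @ vs) (s \<otimes> r \<otimes> s)
      = refl_count us (s \<otimes> r \<otimes> s) + refl_count vs (inv (val us) \<otimes> (s \<otimes> r \<otimes> s) \<otimes> val us)"
    by auto
  also have "inv (val us) \<otimes> (s \<otimes> r \<otimes> s) \<otimes> val us
      = inv (val (s # us)) \<otimes> r \<otimes> val (s # us)"
    using Cons.hyps Cons.prems by (simp add: inv_mult_group m_assoc lists_S_carrier)
  finally show ?case by simp
qed simp

text \<open>The reflections read off from the word \<open>(s t)\<^sup>k\<close> are \<open>(s t)\<^sup>j s\<close> for \<open>j < 2 k\<close>.\<close>

lemma refl_count_relator_power:
  assumes st: "s \<in> S" "t \<in> S" and "r \<in> carrier W"
  shows "refl_count (concat (replicate k [s, t])) r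
    = card {j. j < 2 * k \<and> r = (s \<otimes> t) [^] j \<otimes> s}"
  using \<open>r \<in> carrier W\<close>
proof (induction k arbitrary: r)
  case (Suc k)
  let ?a = "s \<otimes> t"
  have [simp]: "?a \<in> carrier W" using st by auto
  have conj: "t \<otimes> (s \<otimes> r \<otimes> s) \<otimes> t = ?a [^] j \<otimes> s \<longleftrightarrow> r = ?a [^] (j + 2) \<otimes> s" for j :: nat
  proof -
    have "t \<otimes> (s \<otimes> r \<otimes> s) \<otimes> t = ?a [^] j \<otimes> s
      \<longleftrightarrow> s \<otimes> t \<otimes> (t \<otimes> (s \<otimes> r \<otimes> s) \<otimes> t) \<otimes> (t \<otimes> s) = s \<otimes> t \<otimes> (?a [^] j \<otimes> s) \<otimes> (t \<otimes> s)"
      using st Suc.prems by (simp add: mult_left_eq_iff mult_right_eq_iff)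
    also have "s \<otimes> t \<otimes> (t \<otimes> (s \<otimes> r \<otimes> s) \<otimes> t) \<otimes> (t \<otimes> s) = r"
      using st Suc.prems by (simp add: m_assoc)
    also have "s \<otimes> t \<otimes> (?a [^] j \<otimes> s) \<otimes> (t \<otimes> s) = (?a \<otimes> ?a [^] j \<otimes> ?a) \<otimes> s"
      using st by (simp add: m_assoc)
    also have "?a \<otimes> ?a [^] j \<otimes> ?a = ?a [^] (j + 2)"
      by (metis \<open>?a \<in> carrier W\<close> add_2_eq_Suc' nat_pow_Suc nat_pow_Suc2)
    finally show ?thesis by simp
  qed
  have two: "s \<otimes> r \<otimes> s = t \<longleftrightarrow> r = ?a [^] (1::nat) \<otimes> s"
  proof
    assume "s \<otimes> r \<otimes> s = t"
    then have "s \<otimes> (s \<otimes> r \<otimes> s) \<otimes> s = s \<otimes> t \<otimes> s" by simp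
    then show "r = ?a [^] (1::nat) \<otimes> s" using st Suc.prems by (simp add: m_assoc)
  next
    assume "r = ?a [^] (1::nat) \<otimes> s"
    then show "s \<otimes> r \<otimes> s = t" using st by (simp add: m_assoc)
  qed
  have "{j. j < 2 * Suc k \<and> r = ?a [^] j \<otimes> s}
      = {j. j = 0 \<and> r = s} \<union> {j. j = 1 \<and> r = ?a [^] (1::nat) \<otimes> s}
        \<union> (\<lambda>j. j + 2) ` {j. j < 2 * k \<and> r = ?a [^] (j + 2) \<otimes> s}" (is "?L = ?A \<union> ?B \<union> ?C")
  proof (rule Set.set_eqI)
    fix j :: nat
    consider "j = 0" | "j = 1" | i where "j = i + 2"
      by (metis One_nat_def add_2_eq_Suc' not0_implies_Suc)
    then show "j \<in> ?L \<longleftrightarrow> j \<in> ?A \<union> ?B \<union> ?C"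
      using st by cases (auto simp del: nat_pow_Suc)
  qed
  then have "card ?L = card (?A \<union> ?B \<union> ?C)" by simp
  also have "\<dots> = card ?A + card ?B + card ?C"
    by (subst card_Un_disjoint, auto)+
  also have "card ?A = of_bool (r = s)" by simp
  also have "card ?B = of_bool (s \<otimes> r \<otimes> s = t)" unfolding two by simp
  also have "card ?C = card {j. j < 2 * k \<and> r = ?a [^] (j + 2) \<otimes> s}"
    by (rule card_image) (simp add: inj_on_def)
  finally show ?case
    using Suc.IH[of "t \<otimes> (s \<otimes> r \<otimes> s) \<otimes> t"] st Suc.prems by (simp add: conj del: nat_pow_Suc)
qed simp

text \<open>With \<open>m\<close> the order of \<open>s t\<close>, the reflections \<open>(s t)\<^sup>j s\<close> for \<open>j < 2 m\<close> repeat with period \<open>m\<close>, so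
  each of them occurs an even number of times.\<close>

lemma even_refl_count_relator:
  assumes "s \<in> S" "t \<in> S" and "r \<in> carrier W"
  shows "even (refl_count (concat (replicate (ord (s \<otimes> t)) [s, t])) r)"
proof -
  let ?a = "s \<otimes> t" let ?m = "ord (s \<otimes> t)"
  have [simp]: "?a \<in> carrier W" using assms by auto
  define P where "P j \<longleftrightarrow> r = ?a [^] j \<otimes> s" for j :: nat
  have period: "P (j + ?m) = P j" for j
    by (simp add: P_def nat_pow_mult[symmetric])
  let ?A = "{j. j < ?m \<and> P j}"
  have "{j. j < 2 * ?m \<and> P j} = ?A \<union> (\<lambda>j. j + ?m) ` ?A" (is "?L = ?R")
  proof (rule Set.set_eqI)
    fix j
    consider "j < ?m" | i where "j = i + ?m"
      by (metis add.commute le_Suc_ex not_le)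
    then show "j \<in> ?L \<longleftrightarrow> j \<in> ?R" by cases (auto simp: period)
  qed
  also have "card \<dots> = card ?A + card ((\<lambda>j. j + ?m) ` ?A)"
    by (rule card_Un_disjoint) auto
  also have "card ((\<lambda>j. j + ?m) ` ?A) = card ?A"
    by (intro card_image inj_onI) (rule add_right_imp_eq)
  finally show ?thesis
    by (simp add: refl_count_relator_power[OF assms] P_def)
qed

lemma val_relator:
  assumes "s \<in> S" "t \<in> S"
  shows "val (concat (replicate k [s, t])) = (s \<otimes> t) [^] k"
proof (induction k)
  case (Suc k)
  then show ?case using assms nat_pow_Suc2[of "s \<otimes> t" k] by (simp add: m_assoc)
qed simp

lemma even_refl_count_insert:
  assumes "us \<in> lists S" "zs \<in> lists S" "vs \<in> lists S" "val zs = \<one>"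
    and "\<And>r. r \<in> carrier W \<Longrightarrow> even (refl_count zs r)" and "r \<in> carrier W"
  shows "even (refl_count (us @ zs @ vs) r) = even (refl_count (us @ vs) r)"
  using assms by (simp add: refl_count_append)

text \<open>The parity of the reflection count does not change when a relator or a pair of inverse letters is
  inserted. Signs of letters can be forgotten because generators are involutions.\<close>

lemma presented_eq_invariants:
  assumes "presented_eq S (coxeter_relators W S) v w"
  shows "map snd v \<in> lists S \<and> map snd w \<in> lists S \<and>
    (\<forall>r \<in> carrier W. even (refl_count (map snd v) r) = even (refl_count (map snd w) r))"
  using assms
proof induction
  case (cancel u v x b)
  have "even (refl_count (map snd u @ [x, x] @ map snd v) r) = even (refl_count (map snd u @ map snd v) r)"
    if "r \<in> carrier W" for r
  proof (rule even_refl_count_insert)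
    fix r assume "r \<in> carrier W"
    have "x \<otimes> r \<otimes> x = x \<longleftrightarrow> r = x" 
    proof
      assume "x \<otimes> r \<otimes> x = x"
      then have "x \<otimes> (x \<otimes> r \<otimes> x) \<otimes> x = x \<otimes> x \<otimes> x" by (simp)
      then show "r = x" using cancel \<open>r \<in> carrier W\<close> by (simp add: m_assoc)
    qed (use cancel in simp)
    then show "even (refl_count [x, x] r)" by simp
  qed (use cancel that in \<open>auto simp: in_lists_conv_set\<close>)
  then show ?case using cancel by (auto simp: in_lists_conv_set)
next
  case (relator u v r)
  obtain s t where st: "s \<in> S" "t \<in> S"
    and r: "r = concat (replicate (ord (s \<otimes> t)) [(True, s), (True, t)])"
    using relator.hyps(3) by (auto simp: coxeter_relators_def)
  have mr: "map snd r = concat (replicate (ord (s \<otimes> t)) [s, t])"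
    unfolding r by (simp add: map_concat)
  have l: "map snd r \<in> lists S" unfolding mr using st by (auto simp: in_lists_conv_set)
  have uv: "map snd u \<in> lists S" "map snd v \<in> lists S"
    using relator.hyps(1,2) by (auto simp: in_lists_conv_set)
  have "val (map snd r) = \<one>" using st unfolding mr val_relator[OF st] by simp
  moreover have "even (refl_count (map snd r) x)" if "x \<in> carrier W" for x
    unfolding mr by (rule even_refl_count_relator[OF st that])
  ultimately show ?case
    using even_refl_count_insert[OF uv(1) l uv(2)] l uv by simp
qed (auto simp: in_lists_conv_set)

lemma even_refl_count_cong:
  assumes "v \<in> lists S" "w \<in> lists S" "val v = val w" "r \<in> carrier W"
  shows "even (refl_count v r) = even (refl_count w r)"
proof -
  have gv: "gword_value W (map (Pair True) u) = val u" for u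
    by (induction u) (auto simp: gword_value_def letter_value_def)
  have l: "map (Pair True) u \<in> lists (UNIV \<times> S)" if "u \<in> lists S" for u
    using that by (auto simp: in_lists_conv_set)
  have "has_presentation W S (coxeter_relators W S)"
    using cs by (simp add: coxeter_system_def)
  then have "presented_eq S (coxeter_relators W S) (map (Pair True) v) (map (Pair True) w)"
    unfolding has_presentation_def using assms(3) l[OF assms(1)] l[OF assms(2)]
    by (metis gv)
  from presented_eq_invariants[OF this] assms(4) show ?thesis
    by (simp add: comp_def)
qed

lemma refl_count_deletion:
  assumes "ws \<in> lists S" "r \<in> carrier W" "refl_count ws r \<noteq> 0"
  shows "\<exists>us x vs. ws = us @ x # vs \<and> r \<otimes> val ws = val (us @ vs)"
  using assms
proof (induction ws arbitrary: r)
  case (Cons s ws)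
  show ?case
  proof (cases "r = s")
    case True
    then show ?thesis using Cons.hyps Cons.prems by (intro exI[of _ "[]"] exI[of _ s] exI[of _ ws]) auto
  next
    case False
    then obtain us x vs where *: "ws = us @ x # vs" "s \<otimes> r \<otimes> s \<otimes> val ws = val (us @ vs)"
      using Cons.IH[of "s \<otimes> r \<otimes> s"] Cons.hyps Cons.prems by auto
    have "r \<otimes> val (s # ws) = s \<otimes> (s \<otimes> r \<otimes> s \<otimes> val ws)"
      using Cons.hyps Cons.prems by (auto simp: m_assoc)
    then show ?thesis using * by (intro exI[of _ "s # us"] exI[of _ x] exI[of _ vs]) auto
  qed
qed simp

section \<open>Length\<close>

lemma len_def: "len w = (LEAST n. \<exists>ss \<in> lists S. length ss = n \<and> val ss = w)"
  by (simp add: cox_length_def val_def)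

lemma len_le: "ws \<in> lists S \<Longrightarrow> len (val ws) \<le> length ws"
  unfolding len_def by (rule Least_le) blast

lemma reduced_word:
  assumes "x \<in> carrier W"
  obtains ws where "ws \<in> lists S" "val ws = x" "length ws = len x"
proof -
  obtain ws where "ws \<in> lists S" "val ws = x" using obtain_word assms by blast
  then have "\<exists>n. \<exists>ss \<in> lists S. length ss = n \<and> val ss = x" by blast
  from LeastI_ex[OF this] show ?thesis using that unfolding len_def[symmetric] by blast
qed

lemma len_one [simp]: "len \<one> = 0"
  using len_le[of "[]"] by simp

lemma len_eq_0_iff: "x \<in> carrier W \<Longrightarrow> len x = 0 \<longleftrightarrow> x = \<one>"
  by (metis len_one length_0_conv reduced_word val_simps(1))

lemma len_mult_le:
  assumes "x \<in> carrier W" "y \<in> carrier W"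
  shows "len (x \<otimes> y) \<le> len x + len y"
proof -
  obtain u v where "u \<in> lists S" "val u = x" "length u = len x"
    "v \<in> lists S" "val v = y" "length v = len y"
    using reduced_word assms by metis
  then show ?thesis using len_le[of "u @ v"] by simp
qed

lemma len_inv [simp]:
  assumes "x \<in> carrier W"
  shows "len (inv x) = len x"
proof -
  have "len (inv y) \<le> len y" if y: "y \<in> carrier W" for y
  proof -
    obtain ws where "ws \<in> lists S" "val ws = y" "length ws = len y"
      by (rule reduced_word[OF y])
    then show ?thesis using len_le[of "rev ws"] val_rev[of ws] by simp
  qed
  from this[of x] this[of "inv x"] assms show ?thesis by simp
qed

lemma len_gen [simp]: "s \<in> S \<Longrightarrow> len s = 1"
  using len_le[of "[s]"] len_eq_0_iff[of s] gen_not_one[of s] by fastforce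

text \<open>Let \<open>v\<close> be a reduced word of \<open>s w\<close>. If \<open>s\<close> occurred an odd number of times among the reflections of
  \<open>v\<close>, a letter of \<open>v\<close> could be deleted to give a word for \<open>w\<close>, contrary to \<open>\<ell>(s w) \<le> \<ell>(w)\<close>. So \<open>s\<close> occurs an odd number
  of times in \<open>s v\<close>, hence by invariance in every word of \<open>w\<close>, and deletion applies to that word.\<close>

lemma left_exchange:
  assumes ws: "ws \<in> lists S" and s: "s \<in> S" and le: "len (s \<otimes> val ws) \<le> len (val ws)"
  shows "\<exists>us x vs. ws = us @ x # vs \<and> s \<otimes> val ws = val (us @ vs)"
proof -
  have c: "s \<otimes> val ws \<in> carrier W" using ws s by simp
  obtain v where v: "v \<in> lists S" "val v = s \<otimes> val ws" "length v = len (s \<otimes> val ws)"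
    by (rule reduced_word[OF c])
  have sv: "val (s # v) = val ws" using v ws s by simp
  have "even (refl_count v s)"
  proof (rule ccontr)
    assume "odd (refl_count v s)"
    then have "refl_count v s \<noteq> 0" by (metis even_zero)
    then obtain us x vs where *: "v = us @ x # vs" "s \<otimes> val v = val (us @ vs)"
      using refl_count_deletion[of v s] v(1) s by blast
    then have "val ws = val (us @ vs)" using sv by simp
    then have "len (val ws) \<le> length (us @ vs)" using len_le[of "us @ vs"] v(1) *(1) by simp
    then show False using v(3) *(1) le by simp
  qed
  then have "odd (refl_count (s # v) s)" using s by (simp add: m_assoc)
  then have "odd (refl_count ws s)"
    using even_refl_count_cong[of "s # v" ws s] sv v(1) ws s by auto
  then have "refl_count ws s \<noteq> 0" by (metis even_zero)
  then show ?thesis using refl_count_deletion[of ws s] ws s by blast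
qed

lemma right_exchange:
  assumes ws: "ws \<in> lists S" and s: "s \<in> S" and le: "len (val ws \<otimes> s) \<le> len (val ws)"
  shows "\<exists>us x vs. ws = us @ x # vs \<and> val ws \<otimes> s = val (us @ vs)"
proof -
  have r: "rev ws \<in> lists S" using ws by simp
  have e: "s \<otimes> val (rev ws) = inv (val ws \<otimes> s)" using ws s by (simp add: val_rev inv_mult_group)
  have "len (s \<otimes> val (rev ws)) \<le> len (val (rev ws))"
    using le ws s unfolding e by (simp add: val_rev)
  then obtain us x vs where *: "rev ws = us @ x # vs" "s \<otimes> val (rev ws) = val (us @ vs)"
    using left_exchange[OF r s] by blast
  have "us @ vs \<in> lists S" using r *(1) by simp
  then have "val (rev (us @ vs)) = val ws \<otimes> s" using *(2) ws s 
    by (metis e inv_inv gen_carrier m_closed val_S val_rev)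
  moreover have "ws = rev vs @ x # rev us" using arg_cong[OF *(1), of rev] by simp
  ultimately show ?thesis by (metis rev_append)
qed

lemma len_gen_mult_le: "s \<in> S \<Longrightarrow> x \<in> carrier W \<Longrightarrow> len (s \<otimes> x) \<le> Suc (len x)"
  using len_mult_le[of s x] by simp

lemma len_mult_gen_le: "s \<in> S \<Longrightarrow> x \<in> carrier W \<Longrightarrow> len (x \<otimes> s) \<le> Suc (len x)"
  using len_mult_le[of x s] by simp

lemma len_le_gen_mult: "s \<in> S \<Longrightarrow> x \<in> carrier W \<Longrightarrow> len x \<le> Suc (len (s \<otimes> x))"
  using len_gen_mult_le[of s "s \<otimes> x"] by simp

section \<open>Parabolic subgroups and minimal coset representatives\<close>

lemma generate_inv: "K \<subseteq> S \<Longrightarrow> x \<in> generate W K \<Longrightarrow> inv x \<in> generate W K"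
  using generate_m_inv_closed[of K x] by auto

lemma reduced_word_parabolic:
  assumes K: "K \<subseteq> S" and x: "x \<in> generate W K"
  obtains ws where "ws \<in> lists K" "val ws = x" "length ws = len x"
proof -
  have "\<exists>vs \<in> lists K. val vs = val ws \<and> length vs = len (val ws)" if "ws \<in> lists K" for ws
    using that
  proof induction
    case (Cons s ws)
    then obtain vs where vs: "vs \<in> lists K" "val vs = val ws" "length vs = len (val ws)" by blast
    have s: "s \<in> S" and vsS: "vs \<in> lists S" using Cons.hyps(1) vs(1) K by auto
    show ?case
    proof (cases "len (s \<otimes> val vs) \<le> len (val vs)")
      case True
      then obtain us x zs where *: "vs = us @ x # zs" "s \<otimes> val vs = val (us @ zs)"
        using left_exchange[OF vsS s] by blast
      have "len (val vs) \<le> Suc (len (s \<otimes> val vs))" using s vsS by (intro len_le_gen_mult) auto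
      moreover have "len (val (us @ zs)) \<le> length (us @ zs)"
        using len_le[of "us @ zs"] vsS *(1) by simp
      ultimately have "length (us @ zs) = len (s \<otimes> val vs)"
        using * vs(2,3) by simp
      then show ?thesis using * vs by (intro bexI[of _ "us @ zs"]) auto
    next
      case False
      then have "len (s \<otimes> val vs) = Suc (len (val vs))"
        using len_gen_mult_le[OF s, of "val vs"] vsS by simp
      then show ?thesis using Cons.hyps(1) vs by (intro bexI[of _ "s # vs"]) auto
    qed
  qed (auto intro: bexI[of _ "[]"])
  then show ?thesis using x that unfolding generate_eq_val[OF K] by blast
qed

lemma mem_parabolic_of_len_le_1:
  assumes "K \<subseteq> S" "x \<in> generate W K" "x \<noteq> \<one>" "len x \<le> 1"
  shows "x \<in> K"
proof -
  obtain ws where ws: "ws \<in> lists K" "val ws = x" "length ws = len x"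
    by (rule reduced_word_parabolic[OF assms(1,2)])
  then have "ws \<noteq> []" using assms(3) by auto
  moreover have "length ws \<le> 1" using ws(3) assms(4) by simp
  ultimately obtain s where "ws = [s]" by (cases ws) auto
  then show ?thesis using ws assms(1) by auto
qed

text \<open>For \<open>K \<subseteq> S\<close> these are the elements of \<open>W\<^sup>K\<close>.\<close>

definition right_min :: "'a set \<Rightarrow> 'a \<Rightarrow> bool" where
  "right_min K y \<longleftrightarrow> y \<in> carrier W \<and> (\<forall>k\<in>K. len y < len (y \<otimes> k))"

lemma right_min_carrier: "right_min K y \<Longrightarrow> y \<in> carrier W"
  by (simp add: right_min_def)

text \<open>Exchange applied to the concatenation of reduced words of \<open>y\<close> and \<open>w\<close>: the deleted letter lies in
  one of the two factors.\<close>

lemma right_exchange_product: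
  assumes y: "y \<in> carrier W" and w: "w \<in> carrier W" and s: "s \<in> S"
    and le: "len (y \<otimes> w \<otimes> s) \<le> len (y \<otimes> w)"
  obtains (left) y' where "y' \<in> carrier W" "len y' < len y" "y \<otimes> w \<otimes> s = y' \<otimes> w"
  | (right) "len (w \<otimes> s) < len w"
proof -
  obtain u where u: "u \<in> lists S" "val u = y" "length u = len y"
    by (rule reduced_word[OF y])
  obtain v where v: "v \<in> lists S" "val v = w" "length v = len w"
    by (rule reduced_word[OF w])
  have uv: "u @ v \<in> lists S" "val (u @ v) = y \<otimes> w" using u v by auto
  obtain us x zs where *: "u @ v = us @ x # zs" "y \<otimes> w \<otimes> s = val (us @ zs)"
    using right_exchange[OF uv(1) s] le unfolding uv(2) by blast
  consider (left) zs' where "u = us @ x # zs'" "zs = zs' @ v"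
    | (right) us' where "us = u @ us'" "v = us' @ x # zs"
    using *(1) by (auto simp: append_eq_append_conv2 append_eq_Cons_conv)
  then show ?thesis
  proof cases
    case left
    have z: "us @ zs' \<in> lists S" using u(1) left(1) by auto
    have "y \<otimes> w \<otimes> s = val (us @ zs') \<otimes> w"
      unfolding *(2) left(2) append_assoc[symmetric] val_append_S[OF z v(1)] v(2) ..
    moreover have "len (val (us @ zs')) < len y" using len_le[OF z] u(3) left(1) by simp
    ultimately show ?thesis using that(1) val_S[OF z] by blast
  next
    case right
    have z: "us' @ zs \<in> lists S" using v(1) right(2) by auto
    have "y \<otimes> val (us' @ zs) = y \<otimes> (w \<otimes> s)"
      using val_append_S[OF u(1) z] *(2) right(1) u(2) y w s by (simp add: m_assoc)
    then have "val (us' @ zs) = w \<otimes> s"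
      using mult_left_eq_iff[OF val_S[OF z] _ y] w s by simp
    then show ?thesis using that(2) len_le[OF z] v(3) right(2) by simp
  qed
qed

text \<open>Letters of a reduced word of \<open>w\<close> are appended to \<open>y\<close> one at a time. By exchange, a letter that did not
  increase the length would delete a letter of \<open>y\<close>, giving a shorter element of the coset \<open>y W\<^sub>K\<close>, or a letter
  of the reduced word.\<close>

lemma len_mult_coset_min:
  assumes K: "K \<subseteq> S" and y: "y \<in> carrier W" and min: "\<forall>w \<in> generate W K. len y \<le> len (y \<otimes> w)"
    and w: "w \<in> generate W K"
  shows "len (y \<otimes> w) = len y + len w"
proof -
  have "len (y \<otimes> val vs) = len y + length vs"
    if "vs \<in> lists K" "length vs = len (val vs)" for vs
    using that
  proof (induction vs rule: rev_induct)
    case (snoc k vs)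
    have vsK: "vs \<in> lists K" and k: "k \<in> K" using snoc.prems(1) by auto
    have vsS: "vs \<in> lists S" and kS: "k \<in> S" using vsK k K by auto
    have c: "val vs \<in> carrier W" "y \<otimes> val vs \<in> carrier W" using vsS y by auto
    have v: "val (vs @ [k]) = val vs \<otimes> k" using vsS kS by simp
    have "length vs \<le> len (val vs)"
      using snoc.prems(2) len_mult_gen_le[OF kS c(1)] v by simp
    then have red: "length vs = len (val vs)" using len_le[OF vsS] by simp
    then have IH: "len (y \<otimes> val vs) = len y + length vs" using snoc.IH vsK by blast
    have "\<not> len (y \<otimes> val vs \<otimes> k) \<le> len (y \<otimes> val vs)"
    proof
      assume le: "len (y \<otimes> val vs \<otimes> k) \<le> len (y \<otimes> val vs)"
      show False
      proof (cases rule: right_exchange_product[OF y c(1) kS le, case_names left right])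
        case (left y')
        have "y \<otimes> (val vs \<otimes> k \<otimes> inv (val vs)) = y \<otimes> val vs \<otimes> k \<otimes> inv (val vs)"
          using y c kS by (simp add: m_assoc)
        also have "\<dots> = y'" unfolding left(3) using left(1) c by (simp add: m_assoc)
        finally have "len (y \<otimes> (val vs \<otimes> k \<otimes> inv (val vs))) < len y" using left(2) by simp
        moreover have "val vs \<otimes> k \<otimes> inv (val vs) \<in> generate W K"
          using imageI[OF vsK, of val] k unfolding generate_eq_val[OF K, symmetric]
          by (simp add: generate.eng generate_inv[OF K] generate.incl)
        ultimately show False using min by fastforce
      next
        case right
        then show False using snoc.prems(2) red v by simp
      qed
    qed
    then have "len (y \<otimes> val vs \<otimes> k) = Suc (len (y \<otimes> val vs))"
      using len_mult_gen_le[OF kS c(2)] by simp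
    then show ?case using IH v y c kS by (simp add: m_assoc)
  qed (use y in simp)
  moreover obtain vs where "vs \<in> lists K" "val vs = w" "length vs = len w"
    by (rule reduced_word_parabolic[OF K w])
  ultimately show ?thesis by metis
qed

lemma parabolic_decomposition_min:
  assumes K: "K \<subseteq> S" and x: "x \<in> carrier W"
  obtains y z where "y \<in> carrier W" "z \<in> generate W K" "x = y \<otimes> z"
    "\<forall>w \<in> generate W K. len y \<le> len (y \<otimes> w)"
proof -
  obtain w where w: "w \<in> generate W K"
    and min: "\<And>w'. w' \<in> generate W K \<Longrightarrow> len (x \<otimes> w) \<le> len (x \<otimes> w')"
    using ex_has_least_nat[of "\<lambda>w. w \<in> generate W K" \<one> "\<lambda>w. len (x \<otimes> w)"] generate.one by metis
  have c: "w \<in> carrier W" using generate_carrier[OF K w] .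
  show ?thesis
  proof (rule that[of "x \<otimes> w" "inv w"])
    show "\<forall>w' \<in> generate W K. len (x \<otimes> w) \<le> len (x \<otimes> w \<otimes> w')"
      using min generate.eng[OF w] generate_carrier[OF K] c x by (simp add: m_assoc)
  qed (use x c w generate_inv[OF K] in \<open>auto simp: m_assoc\<close>)
qed

text \<open>An element without descents in \<open>K\<close> is the shortest element of its coset: otherwise the last letter of
  a reduced word of its \<open>W\<^sub>K\<close>-part would be a descent.\<close>

lemma len_mult_right_min:
  assumes K: "K \<subseteq> S" and y: "right_min K y" and w: "w \<in> generate W K"
  shows "len (y \<otimes> w) = len y + len w"
proof -
  have yc: "y \<in> carrier W" using y by (rule right_min_carrier)
  obtain y0 z where y0: "y0 \<in> carrier W" "z \<in> generate W K" "y = y0 \<otimes> z"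
    "\<forall>w \<in> generate W K. len y0 \<le> len (y0 \<otimes> w)"
    by (rule parabolic_decomposition_min[OF K yc])
  note add = len_mult_coset_min[OF K y0(1,4)]
  obtain vs where vs: "vs \<in> lists K" "val vs = z" "length vs = len z"
    by (rule reduced_word_parabolic[OF K y0(2)])
  have "vs = []"
  proof (cases vs rule: rev_cases)
    case (snoc us k)
    have k: "k \<in> K" "k \<in> S" and us: "us \<in> lists K" "us \<in> lists S" using vs(1) snoc K by auto
    have "z = val us \<otimes> k" using vs(2) snoc val_append_S[OF us(2), of "[k]"] k by simp
    then have zk: "val us = z \<otimes> k" using k(2) val_S[OF us(2)] by simp
    have "val us \<in> generate W K" using us generate_eq_val[OF K] by simp
    then have "len (y0 \<otimes> val us) = len y0 + len (val us)" by (rule add)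
    also have "\<dots> < len y0 + len z" using len_le[OF us(2)] vs(3) snoc by simp
    also have "\<dots> = len y" using add[OF y0(2)] y0(3) by simp
    finally have "len (y \<otimes> k) < len y"
      using y0(1,3) zk k generate_carrier[OF K y0(2)] by (simp add: m_assoc)
    then show ?thesis using y k by (auto simp: right_min_def)
  qed simp
  then have "z = \<one>" using vs(2) by simp
  then have "y = y0" using y0(1,3) by simp
  then show ?thesis using add[OF w] by simp
qed

lemma parabolic_decomposition:
  assumes K: "K \<subseteq> S" and x: "x \<in> carrier W"
  obtains y z where "right_min K y" "z \<in> generate W K" "x = y \<otimes> z"
proof -
  obtain y z where y: "y \<in> carrier W" "z \<in> generate W K" "x = y \<otimes> z"
    "\<forall>w \<in> generate W K. len y \<le> len (y \<otimes> w)"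
    by (rule parabolic_decomposition_min[OF K x])
  have "right_min K y" unfolding right_min_def
  proof (intro conjI ballI)
    fix k assume "k \<in> K"
    then have "len (y \<otimes> k) = len y + len k"
      by (intro len_mult_coset_min[OF K y(1,4)] generate.incl)
    moreover have "len k = 1" using \<open>k \<in> K\<close> K by (intro len_gen) auto
    ultimately show "len y < len (y \<otimes> k)" by simp
  qed (fact y(1))
  then show ?thesis using that y by blast
qed

lemma parabolic_decomposition_unique:
  assumes K: "K \<subseteq> S" and y: "right_min K y" "right_min K y'"
    and z: "z \<in> generate W K" "z' \<in> generate W K" and eq: "y \<otimes> z = y' \<otimes> z'"
  shows "y = y' \<and> z = z'"
proof -
  have c: "y \<in> carrier W" "y' \<in> carrier W" "z \<in> carrier W" "z' \<in> carrier W"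
    using y z right_min_carrier generate_carrier[OF K] by auto
  let ?a = "z \<otimes> inv z'"
  have a: "?a \<in> generate W K" using z generate_inv[OF K] by (intro generate.eng) auto
  have ac: "?a \<in> carrier W" using c by simp
  have "y \<otimes> ?a = y \<otimes> z \<otimes> inv z'" using c by (simp add: m_assoc)
  also have "\<dots> = y'" unfolding eq using c by (simp add: m_assoc)
  finally have y': "y' = y \<otimes> ?a" by simp
  have "y' \<otimes> inv ?a = y" unfolding y' using c(1) ac by (simp add: m_assoc)
  moreover have "len (y' \<otimes> inv ?a) = len y' + len (inv ?a)"
    by (rule len_mult_right_min[OF K y(2) generate_inv[OF K a]])
  moreover have "len y' = len y + len ?a" unfolding y'
    by (rule len_mult_right_min[OF K y(1) a])
  ultimately have "len ?a = 0" by simp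
  then have "?a = \<one>" using len_eq_0_iff[OF ac] by simp
  then have "y = y'" using y' c by simp
  then show ?thesis using eq c mult_left_eq_iff[of z z' y'] by simp
qed

text \<open>Additivity of length gives \<open>\<ell>(y) + \<ell>(r) = \<ell>(y r) = \<ell>(s y) \<le> \<ell>(y) + 1\<close>, so \<open>\<ell>(r) \<le> 1\<close>.
  This is why conjugates of simple reflections stay simple in the factorisations below.\<close>

lemma mem_of_conj_simple:
  assumes K: "K \<subseteq> S" and y: "right_min K y" and r: "r \<in> generate W K" "r \<noteq> \<one>"
    and s: "s \<in> S" "y \<otimes> r = s \<otimes> y"
  shows "r \<in> K"
proof -
  have "len y + len r = len (s \<otimes> y)" using len_mult_right_min[OF K y r(1)] s(2) by simp
  also have "\<dots> \<le> Suc (len y)" using s(1) right_min_carrier[OF y] by (rule len_gen_mult_le)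
  finally show ?thesis using mem_parabolic_of_len_le_1[OF K r] by simp
qed

text \<open>Deodhar's lemma. If some \<open>k \<in> K\<close> does not lengthen \<open>s y\<close> on the right, exchange deletes
  a letter from \<open>s\<close> followed by a reduced word of \<open>y\<close>; since \<open>k\<close> is not a descent of \<open>y\<close>, the deleted letter is the initial \<open>s\<close>, so \<open>s y k = y\<close>.\<close>

lemma right_min_gen_mult:
  assumes K: "K \<subseteq> S" and y: "right_min K y" and s: "s \<in> S"
  shows "right_min K (s \<otimes> y) \<or> (\<exists>k\<in>K. s \<otimes> y = y \<otimes> k)"
proof (cases "right_min K (s \<otimes> y)")
  case False
  have yc: "y \<in> carrier W" using y by (rule right_min_carrier)
  with False s obtain k where k: "k \<in> K" "len (s \<otimes> y \<otimes> k) \<le> len (s \<otimes> y)"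
    by (auto simp: right_min_def not_less)
  have kS: "k \<in> S" using k K by auto
  obtain u where u: "u \<in> lists S" "val u = y" "length u = len y"
    by (rule reduced_word[OF yc])
  have su: "s # u \<in> lists S" "val (s # u) = s \<otimes> y" using s u by auto
  obtain us x vs where *: "s # u = us @ x # vs" "s \<otimes> y \<otimes> k = val (us @ vs)"
    using right_exchange[OF su(1) kS] k(2) unfolding su(2) by blast
  have "us = []"
  proof (cases us)
    case (Cons s' us')
    then have u': "u = us' @ x # vs" "s' = s" using *(1) by auto
    have l: "us' @ vs \<in> lists S" using u(1) u' by auto
    have "s \<otimes> (y \<otimes> k) = s \<otimes> val (us' @ vs)"
      using *(2) Cons u' s yc kS by (simp add: m_assoc)
    then have "y \<otimes> k = val (us' @ vs)"
      using mult_left_eq_iff[OF _ val_S[OF l], of "y \<otimes> k" s] s yc kS by simp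
    then have "len (y \<otimes> k) < len y" using len_le[OF l] u(3) u' by simp
    then show ?thesis using y k by (auto simp: right_min_def)
  qed simp
  then have "s \<otimes> y \<otimes> k = y" using * u(2) by simp
  then have "s \<otimes> y \<otimes> k \<otimes> k = y \<otimes> k" by simp
  then have "s \<otimes> y = y \<otimes> k" using s yc kS by simp
  then show ?thesis using k by blast
qed simp

section \<open>Conjugating simple reflections to simple reflections\<close>

definition conj_reps :: "'a set \<Rightarrow> 'a set \<Rightarrow> 'a set \<Rightarrow> 'a set \<Rightarrow> 'a set" where
  "conj_reps S' J K Q = {x \<in> double_min_reps W S S' J K. \<forall>q\<in>Q. x \<otimes> q \<otimes> inv x \<in> J}"

lemma double_min_reps_iff:
  assumes "S' \<subseteq> S"
  shows "x \<in> double_min_reps W S S' J K \<longleftrightarrow>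
    x \<in> generate W S' \<and> (\<forall>s\<in>J. len x < len (s \<otimes> x)) \<and> right_min K x"
  using generate_carrier[OF assms]
  by (auto simp: double_min_reps_def left_min_reps_def right_min_reps_def right_min_def)

lemma conj_reps_carrier: "S' \<subseteq> S \<Longrightarrow> conj_reps S' J K Q \<subseteq> carrier W"
  using generate_carrier by (auto simp: conj_reps_def double_min_reps_iff)

text \<open>The condition \<open>K \<inter> x\<inverse> J x = Q\<close> is more convenient as a description of \<open>Q\<close> in terms of \<open>x\<close>.\<close>

lemma p_set_eq:
  assumes "S' \<subseteq> S" "J \<subseteq> S" "K \<subseteq> S"
  shows "p_set W S S' Q J K = {x \<in> double_min_reps W S S' J K. Q = {k \<in> K. x \<otimes> k \<otimes> inv x \<in> J}}"
proof -
  have "K \<inter> (\<lambda>s. inv x \<otimes> s \<otimes> x) ` J = {k \<in> K. x \<otimes> k \<otimes> inv x \<in> J}" if "x \<in> carrier W" for x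
  proof -
    have "k \<in> (\<lambda>s. inv x \<otimes> s \<otimes> x) ` J \<longleftrightarrow> x \<otimes> k \<otimes> inv x \<in> J" if "k \<in> K" for k
    proof
      assume "k \<in> (\<lambda>s. inv x \<otimes> s \<otimes> x) ` J"
      then obtain s where s: "s \<in> J" "k = inv x \<otimes> s \<otimes> x" by blast
      then have "x \<otimes> k \<otimes> inv x = s"
        using \<open>x \<in> carrier W\<close> subsetD[OF assms(2) s(1)] by (simp add: m_assoc)
      then show "x \<otimes> k \<otimes> inv x \<in> J" using s by simp
    next
      assume *: "x \<otimes> k \<otimes> inv x \<in> J"
      have "k \<in> carrier W" using that assms(3) by auto
      then have "k = inv x \<otimes> (x \<otimes> k \<otimes> inv x) \<otimes> x"
        using \<open>x \<in> carrier W\<close> by (simp add: m_assoc)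
      then show "k \<in> (\<lambda>s. inv x \<otimes> s \<otimes> x) ` J" using * by blast
    qed
    then show ?thesis by blast
  qed
  then show ?thesis
    unfolding p_set_def using generate_carrier[OF assms(1)]
    by (auto simp: double_min_reps_iff[OF assms(1)])
qed

lemma p_set_carrier: "S' \<subseteq> S \<Longrightarrow> p_set W S S' Q J K \<subseteq> carrier W"
  using generate_carrier by (auto simp: p_set_def double_min_reps_iff)

lemma p_set_diagonal:
  assumes "S' \<subseteq> S" "J \<subseteq> S" "Q \<subseteq> S"
  shows "p_set W S S' Q J Q = conj_reps S' J Q Q"
  unfolding p_set_eq[OF assms] conj_reps_def by blast

lemma conj_reps_eq_Union:
  assumes "S' \<subseteq> S" "J \<subseteq> S" "K \<subseteq> S" "Q \<subseteq> K"
  shows "conj_reps S' J K Q = (\<Union>Q'\<in>{Q'. Q \<subseteq> Q' \<and> Q' \<subseteq> K}. p_set W S S' Q' J K)"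
proof (rule Set.set_eqI)
  fix x
  let ?Q = "{k \<in> K. x \<otimes> k \<otimes> inv x \<in> J}"
  have "x \<in> conj_reps S' J K Q \<longleftrightarrow> x \<in> double_min_reps W S S' J K \<and> Q \<subseteq> ?Q"
    using assms(4) by (auto simp: conj_reps_def)
  then show "x \<in> conj_reps S' J K Q \<longleftrightarrow>
      x \<in> (\<Union>Q'\<in>{Q'. Q \<subseteq> Q' \<and> Q' \<subseteq> K}. p_set W S S' Q' J K)"
    by (simp add: p_set_eq[OF assms(1-3)])
qed

lemma conj_mult:
  assumes "y \<in> carrier W" "z \<in> carrier W" "q \<in> carrier W"
  shows "(y \<otimes> z) \<otimes> q \<otimes> inv (y \<otimes> z) = y \<otimes> (z \<otimes> q \<otimes> inv z) \<otimes> inv y"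
  using assms by (simp add: m_assoc inv_mult_group)

lemma conj_eq_iff:
  "x \<in> carrier W \<Longrightarrow> q \<in> carrier W \<Longrightarrow> s \<in> carrier W \<Longrightarrow> x \<otimes> q \<otimes> inv x = s \<longleftrightarrow> x \<otimes> q = s \<otimes> x"
  by (metis inv_closed inv_solve_right m_closed)

text \<open>The element \<open>z q z\<inverse>\<close> of \<open>W\<^sub>K\<close> becomes simple after conjugation by the minimal representative \<open>y\<close>, so it
  was simple already.\<close>

lemma conj_in_parabolic:
  assumes K: "K \<subseteq> S" and y: "right_min K y" and z: "z \<in> generate W K" and q: "q \<in> K"
    and s: "(y \<otimes> z) \<otimes> q \<otimes> inv (y \<otimes> z) \<in> S"
  shows "z \<otimes> q \<otimes> inv z \<in> K"
proof -
  have yc: "y \<in> carrier W" and zc: "z \<in> carrier W" and qS: "q \<in> S"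
    using y z q K right_min_carrier generate_carrier by auto
  let ?r = "z \<otimes> q \<otimes> inv z"
  have r: "?r \<in> generate W K" using z q generate_inv[OF K z] by (simp add: generate.eng generate.incl)
  have "?r \<noteq> \<one>"
  proof
    assume "?r = \<one>"
    then have "z \<otimes> q = \<one> \<otimes> z" using zc qS conj_eq_iff[of z q \<one>] by auto
    then show False using zc qS gen_not_one by simp
  qed
  moreover have "y \<otimes> ?r \<otimes> inv y \<in> S" using s conj_mult[OF yc zc] qS by simp
  moreover have "y \<otimes> ?r = (y \<otimes> ?r \<otimes> inv y) \<otimes> y" using yc zc qS by (simp add: m_assoc)
  ultimately show ?thesis using mem_of_conj_simple[OF K y r] by blast
qed

text \<open>The factorisation \<open>x = y z\<close> along \<open>W\<^sub>K\<close>, with \<open>Q' = K \<inter> y\<inverse> J y\<close>. From \<open>x\<close> to \<open>(y, z)\<close>, all conditions follow from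
  additivity of length. Conversely, Deodhar's lemma shows that a left multiplication of \<open>x\<close> by \<open>s \<in> J\<close> either
  lengthens \<open>y\<close> or turns into a left multiplication of \<open>z\<close> by an element of \<open>Q'\<close>.\<close>

lemma conj_reps_factor:
  assumes S': "S' \<subseteq> S" and J: "J \<subseteq> S'" and K: "K \<subseteq> S'" and Q: "Q \<subseteq> K"
  shows "conj_reps S' J Q Q
    = (\<Union>Q'\<in>Pow K. (\<lambda>(y, z). y \<otimes> z) ` (p_set W S S' Q' J K \<times> p_set W S K Q Q' Q))"
    (is "?L = ?R")
proof
  have KS: "K \<subseteq> S" and JS: "J \<subseteq> S" and QS: "Q \<subseteq> S" using assms by auto
  have pK: "generate W K \<subseteq> generate W S'" by (rule mono_generate[OF K])
  show "?L \<subseteq> ?R"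
  proof
    fix x assume "x \<in> ?L"
    then have x: "x \<in> generate W S'" "\<And>s. s \<in> J \<Longrightarrow> len x < len (s \<otimes> x)" "right_min Q x"
      "\<And>q. q \<in> Q \<Longrightarrow> x \<otimes> q \<otimes> inv x \<in> J"
      by (auto simp: conj_reps_def double_min_reps_iff[OF S'])
    have xc: "x \<in> carrier W" using generate_carrier[OF S' x(1)] .
    obtain y z where yz: "right_min K y" "z \<in> generate W K" "x = y \<otimes> z"
      by (rule parabolic_decomposition[OF KS xc])
    have yc: "y \<in> carrier W" and zc: "z \<in> carrier W"
      using yz right_min_carrier generate_carrier[OF KS] by auto
    note len_y = len_mult_right_min[OF KS yz(1)]
    define Q' where "Q' = {k \<in> K. y \<otimes> k \<otimes> inv y \<in> J}"
    have "y = x \<otimes> inv z" using yz(3) yc zc by (simp add: m_assoc)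
    then have y_gen: "y \<in> generate W S'"
      using x(1) pK generate_inv[OF KS yz(2)] by (auto intro: generate.eng)
    have "len y < len (s \<otimes> y)" if "s \<in> J" for s
    proof -
      have sS: "s \<in> S" using that JS by blast
      have "len y + len z < len (s \<otimes> x)" using x(2)[OF that] len_y[OF yz(2)] yz(3) by simp
      also have "s \<otimes> x = (s \<otimes> y) \<otimes> z" using yz(3) yc zc sS by (simp add: m_assoc)
      also have "len \<dots> \<le> len (s \<otimes> y) + len z" using yc zc sS by (intro len_mult_le) auto
      finally show ?thesis by simp
    qed
    then have y: "y \<in> p_set W S S' Q' J K"
      using y_gen yz(1) by (simp add: p_set_eq[OF S' JS KS] double_min_reps_iff[OF S'] Q'_def)
    have "len z < len (z \<otimes> q)" if "q \<in> Q" for q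
    proof -
      have qS: "q \<in> S" "q \<in> K" using that QS Q by blast+
      have "len (y \<otimes> z) < len (y \<otimes> z \<otimes> q)" using x(3) yz(3) that by (simp add: right_min_def)
      also have "y \<otimes> z \<otimes> q = y \<otimes> (z \<otimes> q)" using yc zc qS by (simp add: m_assoc)
      finally show ?thesis using len_y yz(2) qS by (simp add: generate.eng generate.incl)
    qed
    then have z_min: "right_min Q z" using zc by (simp add: right_min_def)
    have "len z < len (k \<otimes> z)" if "k \<in> Q'" for k
    proof -
      have k: "k \<in> K" "k \<in> S" "y \<otimes> k \<otimes> inv y \<in> J" using that KS by (auto simp: Q'_def)
      let ?s = "y \<otimes> k \<otimes> inv y"
      have "?s \<otimes> x = y \<otimes> (k \<otimes> z)" using yz(3) yc zc k(2) by (simp add: m_assoc)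
      then have "len (y \<otimes> z) < len (y \<otimes> (k \<otimes> z))" using x(2)[OF k(3)] yz(3) by simp
      then show ?thesis using len_y yz(2) k(1) by (simp add: generate.eng generate.incl)
    qed
    moreover have "z \<otimes> q \<otimes> inv z \<in> Q'" if "q \<in> Q" for q
    proof -
      have q: "q \<in> K" "q \<in> S" using that Q KS by blast+
      have xq: "(y \<otimes> z) \<otimes> q \<otimes> inv (y \<otimes> z) \<in> J" using x(4)[OF that] yz(3) by simp
      then have "z \<otimes> q \<otimes> inv z \<in> K" using JS by (intro conj_in_parabolic[OF KS yz(1,2) q(1)]) auto
      then show ?thesis using xq conj_mult[OF yc zc] q(2) by (simp add: Q'_def)
    qed
    ultimately have "z \<in> conj_reps K Q' Q Q"
      using yz(2) z_min by (simp add: conj_reps_def double_min_reps_iff[OF KS])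
    moreover have "Q' \<subseteq> K" by (auto simp: Q'_def)
    ultimately have "z \<in> p_set W S K Q Q' Q"
      using KS QS by (subst p_set_diagonal) auto
    then show "x \<in> ?R" using y yz(3) \<open>Q' \<subseteq> K\<close> by force
  qed
  show "?R \<subseteq> ?L"
  proof
    fix x assume "x \<in> ?R"
    then obtain Q' y z where Q': "Q' \<subseteq> K" and y_p: "y \<in> p_set W S S' Q' J K"
      and z_p: "z \<in> p_set W S K Q Q' Q" and x: "x = y \<otimes> z" by auto
    have Q'S: "Q' \<subseteq> S" using Q' KS by blast
    have y: "y \<in> generate W S'" "\<And>s. s \<in> J \<Longrightarrow> len y < len (s \<otimes> y)" "right_min K y"
      "Q' = {k \<in> K. y \<otimes> k \<otimes> inv y \<in> J}"
      using y_p by (simp_all add: p_set_eq[OF S' JS KS] double_min_reps_iff[OF S'])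
    have z: "z \<in> generate W K" "\<And>k. k \<in> Q' \<Longrightarrow> len z < len (k \<otimes> z)" "right_min Q z"
      "\<And>q. q \<in> Q \<Longrightarrow> z \<otimes> q \<otimes> inv z \<in> Q'"
      using z_p unfolding p_set_diagonal[OF KS Q'S QS]
      by (simp_all add: conj_reps_def double_min_reps_iff[OF KS])
    have yc: "y \<in> carrier W" and zc: "z \<in> carrier W"
      using y z right_min_carrier generate_carrier[OF KS] by auto
    note len_y = len_mult_right_min[OF KS y(3)]
    have "x \<in> generate W S'" unfolding x using y(1) z(1) pK by (auto intro: generate.eng)
    moreover have "len x < len (s \<otimes> x)" if "s \<in> J" for s
    proof -
      have sS: "s \<in> S" using that JS by blast
      have sx: "s \<otimes> x = s \<otimes> y \<otimes> z" using x yc zc sS by (simp add: m_assoc)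
      consider "right_min K (s \<otimes> y)" | k where "k \<in> K" "s \<otimes> y = y \<otimes> k"
        using right_min_gen_mult[OF KS y(3) sS] by blast
      then show ?thesis
      proof cases
        case 1
        then show ?thesis
          using len_mult_right_min[OF KS 1 z(1)] len_y[OF z(1)] y(2)[OF that] sx x by simp
      next
        case (2 k)
        have kS: "k \<in> S" using 2(1) KS by blast
        have "y \<otimes> k \<otimes> inv y = s" using 2(2) yc kS sS by (subst conj_eq_iff) auto
        then have "k \<in> Q'" using 2(1) y(4) that by simp
        then have "len z < len (k \<otimes> z)" by (rule z(2))
        moreover have "s \<otimes> x = y \<otimes> (k \<otimes> z)" using sx 2(2) yc zc kS by (simp add: m_assoc)
        ultimately show ?thesis
          using len_y[OF z(1)] len_y[of "k \<otimes> z"] z(1) 2(1) x by (simp add: generate.eng generate.incl)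
      qed
    qed
    moreover have "right_min Q x" unfolding right_min_def
    proof (intro conjI ballI)
      fix q assume "q \<in> Q"
      then have q: "q \<in> K" "q \<in> S" using Q QS by blast+
      have "x \<otimes> q = y \<otimes> (z \<otimes> q)" using x yc zc q by (simp add: m_assoc)
      moreover have "len z < len (z \<otimes> q)" using z(3) \<open>q \<in> Q\<close> by (simp add: right_min_def)
      ultimately show "len x < len (x \<otimes> q)"
        using len_y[OF z(1)] len_y[of "z \<otimes> q"] z(1) q x by (simp add: generate.eng generate.incl)
    qed (use x yc zc in simp)
    moreover have "x \<otimes> q \<otimes> inv x \<in> J" if "q \<in> Q" for q
    proof -
      have "q \<in> carrier W" using that QS by blast
      then show ?thesis using z(4)[OF that] y(4) conj_mult[OF yc zc] x by auto
    qed
    ultimately show "x \<in> ?L" by (simp add: conj_reps_def double_min_reps_iff[OF S'])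
  qed
qed

section \<open>Finiteness of the sets with prescribed ascents\<close>

lemma conj_word:
  assumes x: "x \<in> carrier W" and Q: "Q \<subseteq> S" "\<And>q. q \<in> Q \<Longrightarrow> x \<otimes> q \<otimes> inv x \<in> S" and ws: "ws \<in> lists Q"
  shows "\<exists>vs \<in> lists S. length vs = length ws \<and> val vs = x \<otimes> val ws \<otimes> inv x"
  using ws
proof induction
  case Nil
  show ?case using x by (intro bexI[of _ "[]"]) auto
next
  case (Cons q ws)
  then obtain vs where vs: "vs \<in> lists S" "length vs = length ws" "val vs = x \<otimes> val ws \<otimes> inv x"
    by blast
  have c: "q \<in> carrier W" "val ws \<in> carrier W"
    using Cons.hyps Q(1) val_S[OF lists_subset] by auto
  have "x \<otimes> q \<otimes> inv x \<otimes> (x \<otimes> val ws \<otimes> inv x) = x \<otimes> (q \<otimes> val ws) \<otimes> inv x"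
    using x c by (simp add: m_assoc)
  then show ?case
    using vs Q(2)[OF Cons.hyps(1)] by (intro bexI[of _ "(x \<otimes> q \<otimes> inv x) # vs"]) auto
qed

text \<open>For \<open>u \<in> W\<^sub>Q\<close>, conjugation by \<open>x\<close> maps \<open>u\<close> to an element of length
  at most \<open>\<ell>(u)\<close>; hence every \<open>s \<in> S' - Q\<close> is a descent not only of \<open>x\<close> but of all \<open>x u\<close>. Building up a reduced
  word letter by letter, it follows that every \<open>w\<close> in \<open>W\<^sub>S\<^sub>'\<close> is a right factor of some \<open>x u\<close>: a letter that is a
  descent of \<open>x u\<close> is absorbed by exchange, and any other letter lies in \<open>Q\<close> and is absorbed into \<open>u\<close>. If
  \<open>x u = a w\<close> is such a factorisation and \<open>w \<in> W\<^sub>S\<^sub>'\<^sup>Q\<close>, comparing lengths in \<open>a\<inverse> x = w u\<inverse>\<close> gives \<open>\<ell>(w) \<le> \<ell>(x)\<close>.\<close>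

lemma len_le_of_all_descents:
  assumes S': "S' \<subseteq> S" and Q: "Q \<subseteq> S'" and x: "right_min Q x"
    and conj: "\<And>q. q \<in> Q \<Longrightarrow> x \<otimes> q \<otimes> inv x \<in> S"
    and desc: "\<And>s. s \<in> S' - Q \<Longrightarrow> len (x \<otimes> s) \<le> len x"
    and w: "w \<in> generate W S'" "right_min Q w"
  shows "len w \<le> len x"
proof -
  have xc: "x \<in> carrier W" using x by (rule right_min_carrier)
  have QS: "Q \<subseteq> S" using Q S' by blast
  note len_x = len_mult_right_min[OF QS x]
  have descent: "len (x \<otimes> u \<otimes> s) \<le> len (x \<otimes> u)"
    if u: "u \<in> generate W Q" and s: "s \<in> S' - Q" for u s
  proof -
    have uc: "u \<in> carrier W" and sS: "s \<in> S" using generate_carrier[OF QS u] s S' by auto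
    obtain us where us: "us \<in> lists Q" "val us = u" "length us = len u"
      by (rule reduced_word_parabolic[OF QS u])
    obtain vs where "vs \<in> lists S" "length vs = len u" "val vs = x \<otimes> u \<otimes> inv x"
      using conj_word[OF xc QS conj us(1)] us by auto
    then have le: "len (x \<otimes> u \<otimes> inv x) \<le> len u" using len_le by metis
    have "x \<otimes> u \<otimes> s = (x \<otimes> u \<otimes> inv x) \<otimes> (x \<otimes> s)" using xc uc sS by (simp add: m_assoc)
    also have "len \<dots> \<le> len (x \<otimes> u \<otimes> inv x) + len (x \<otimes> s)" using xc uc sS by (intro len_mult_le) auto
    also have "\<dots> \<le> len u + len x" using le desc[OF s] by simp
    finally show ?thesis using len_x[OF u] by simp
  qed
  have "\<exists>u \<in> generate W Q. \<exists>a \<in> carrier W. x \<otimes> u = a \<otimes> val ws \<and> len (x \<otimes> u) = len a + length ws"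
    if "ws \<in> lists S'" "length ws = len (val ws)" for ws
    using that
  proof (induction ws rule: rev_induct)
    case Nil
    show ?case using xc generate.one by (intro bexI[of _ \<one>] bexI[of _ x]) auto
  next
    case (snoc s ws)
    have s: "s \<in> S'" "s \<in> S" and ws: "ws \<in> lists S'" "ws \<in> lists S" using snoc.prems(1) S' by auto
    have wc: "val ws \<in> carrier W" using ws(2) by simp
    have v: "val (ws @ [s]) = val ws \<otimes> s" using ws s by simp
    have "length ws \<le> len (val ws)"
      using snoc.prems(2) len_mult_gen_le[OF s(2) wc] v by simp
    then have red: "length ws = len (val ws)" using len_le[OF ws(2)] by simp
    then obtain u a where ua: "u \<in> generate W Q" "a \<in> carrier W" "x \<otimes> u = a \<otimes> val ws"
      "len (x \<otimes> u) = len a + length ws"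
      using snoc.IH ws(1) by blast
    have uc: "u \<in> carrier W" using generate_carrier[OF QS ua(1)] .
    show ?case
    proof (cases "len (x \<otimes> u \<otimes> s) \<le> len (x \<otimes> u)")
      case True
      then have le: "len (a \<otimes> val ws \<otimes> s) \<le> len (a \<otimes> val ws)" using ua(3) by simp
      show ?thesis
      proof (cases rule: right_exchange_product[OF ua(2) wc s(2) le, case_names left right])
        case (left a')
        have "x \<otimes> u = a' \<otimes> val ws \<otimes> s" using left(3)[symmetric] ua(2,3) wc s(2) by simp
        then have eq: "x \<otimes> u = a' \<otimes> val (ws @ [s])" using v left(1) wc s(2) by (simp add: m_assoc)
        have "len (x \<otimes> u) \<le> len a' + length (ws @ [s])"
          unfolding eq snoc.prems(2) using left(1) wc s(2) v by (intro len_mult_le) auto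
        then have "len (x \<otimes> u) = len a' + length (ws @ [s])" using ua(4) left(2) by simp
        then show ?thesis using eq ua(1) left(1) by blast
      next
        case right
        then show ?thesis using snoc.prems(2) red v by simp
      qed
    next
      case False
      then have "s \<in> Q" using descent[OF ua(1)] s(1) by blast
      then have us: "u \<otimes> s \<in> generate W Q" using ua(1) by (simp add: generate.eng generate.incl)
      have eq: "x \<otimes> (u \<otimes> s) = a \<otimes> val (ws @ [s])"
        using v ua(2,3) xc uc wc s(2) by (metis m_assoc gen_carrier)
      have "len (x \<otimes> u \<otimes> s) = Suc (len (x \<otimes> u))"
        using False len_mult_gen_le[OF s(2), of "x \<otimes> u"] xc uc by simp
      then have "len (x \<otimes> (u \<otimes> s)) = len a + length (ws @ [s])"
        using ua(4) xc uc s(2) by (simp add: m_assoc)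
      then show ?thesis using eq us ua(2) by blast
    qed
  qed
  moreover obtain ws where "ws \<in> lists S'" "val ws = w" "length ws = len w"
    by (rule reduced_word_parabolic[OF S' w(1)])
  ultimately obtain u a where ua: "u \<in> generate W Q" "a \<in> carrier W" "x \<otimes> u = a \<otimes> w"
    "len (x \<otimes> u) = len a + len w"
    by metis
  have c: "u \<in> carrier W" "w \<in> carrier W" using generate_carrier QS S' ua(1) w(1) by blast+
  have "inv a \<otimes> x = w \<otimes> inv u"
    using ua(2,3) xc c by (metis inv_closed inv_solve_left inv_solve_right m_assoc m_closed)
  then have "len w + len (inv u) = len (inv a \<otimes> x)"
    using len_mult_right_min[OF QS w(2) generate_inv[OF QS ua(1)]] by simp
  also have "\<dots> \<le> len a + len x" using len_mult_le[of "inv a" x] ua(2) xc by simp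
  finally show ?thesis using len_x[OF ua(1)] ua(4) c by simp
qed

end

section \<open>Growth series\<close>

locale coxeter_finite_rank = coxeter +
  assumes finite_S: "finite S"
begin

lemma finite_len_le: "finite {x \<in> carrier W. len x \<le> n}"
proof (rule finite_subset)
  show "{x \<in> carrier W. len x \<le> n} \<subseteq> val ` {ws. set ws \<subseteq> S \<and> length ws \<le> n}"
  proof safe
    fix x assume x: "x \<in> carrier W" "len x \<le> n"
    obtain ws where "ws \<in> lists S" "val ws = x" "length ws = len x"
      by (rule reduced_word[OF x(1)])
    then show "x \<in> val ` {ws. set ws \<subseteq> S \<and> length ws \<le> n}"
      using x(2) by (intro image_eqI[of _ _ ws]) auto
  qed
  show "finite (val ` {ws. set ws \<subseteq> S \<and> length ws \<le> n})"
    by (intro finite_imageI finite_lists_length_le finite_S)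
qed

lemma finite_len_eq: "A \<subseteq> carrier W \<Longrightarrow> finite {x \<in> A. len x = n}"
  by (rule finite_subset[OF _ finite_len_le[of n]]) auto

text \<open>The Poincare series with its coefficients moved to the field \<open>\<rat>\<close>, where series with nonzero constant
  term are invertible.\<close>

definition growth_series :: "'a set \<Rightarrow> rat fps" where
  "growth_series A = Abs_fps (\<lambda>n. of_nat (card {x \<in> A. len x = n}))"

lemma growth_series_nth: "fps_nth (growth_series A) n = of_nat (card {x \<in> A. len x = n})"
  by (simp add: growth_series_def)

lemma rational_series_iff:
  "rational_series (poincare_series W S A) \<longleftrightarrow> growth_series A \<in> rational_fps"
  by (simp add: rational_series_def poincare_series_def growth_series_def rational_fps_def)

text \<open>Linear relations between indicator functions pass to the series; the disjoint unions and the
  inclusion-exclusion below are the instances of interest.\<close>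

lemma growth_series_linear:
  assumes "finite I" "\<And>i. i \<in> I \<Longrightarrow> A i \<subseteq> carrier W" "C \<subseteq> carrier W"
    and "\<And>x. x \<in> carrier W \<Longrightarrow> (\<Sum>i\<in>I. c i * of_bool (x \<in> A i)) = (of_bool (x \<in> C) :: rat)"
  shows "(\<Sum>i\<in>I. fps_const (c i) * growth_series (A i)) = growth_series C"
proof (rule fps_ext)
  fix n
  let ?B = "{x \<in> carrier W. len x = n}"
  have fin: "finite ?B" by (intro finite_len_eq) simp
  have card: "of_nat (card {x \<in> D. len x = n}) = (\<Sum>x\<in>?B. of_bool (x \<in> D) :: rat)"
    if "D \<subseteq> carrier W" for D
  proof -
    have "?B \<inter> D = {x \<in> D. len x = n}" using that by auto
    then show ?thesis using fin by (simp add: of_bool_def sum.If_cases Int_def[symmetric])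
  qed
  have "fps_nth (\<Sum>i\<in>I. fps_const (c i) * growth_series (A i)) n
      = (\<Sum>i\<in>I. \<Sum>x\<in>?B. c i * of_bool (x \<in> A i))"
    by (simp add: fps_sum_nth growth_series_nth card assms(2) sum_distrib_left cong: sum.cong)
  also have "\<dots> = (\<Sum>x\<in>?B. \<Sum>i\<in>I. c i * of_bool (x \<in> A i))" by (rule sum.swap)
  also have "\<dots> = (\<Sum>x\<in>?B. of_bool (x \<in> C))" by (rule sum.cong[OF HOL.refl], rule assms(4)) auto
  also have "\<dots> = fps_nth (growth_series C) n"
    unfolding growth_series_nth by (rule card[OF assms(3), symmetric])
  finally show "fps_nth (\<Sum>i\<in>I. fps_const (c i) * growth_series (A i)) n = fps_nth (growth_series C) n" .
qed

lemma growth_series_UNION: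
  assumes "finite I" "\<And>i. i \<in> I \<Longrightarrow> A i \<subseteq> carrier W"
    and "\<And>i j x. i \<in> I \<Longrightarrow> j \<in> I \<Longrightarrow> x \<in> A i \<Longrightarrow> x \<in> A j \<Longrightarrow> i = j"
  shows "growth_series (\<Union>i\<in>I. A i) = (\<Sum>i\<in>I. growth_series (A i))"
proof -
  have "(\<Sum>i\<in>I. 1 * of_bool (x \<in> A i)) = (of_bool (x \<in> (\<Union>i\<in>I. A i)) :: rat)" for x
  proof (cases "\<exists>i\<in>I. x \<in> A i")
    case True
    then obtain i where i: "i \<in> I" "x \<in> A i" by blast
    then have "(\<Sum>j\<in>I. 1 * of_bool (x \<in> A j)) = (\<Sum>j\<in>I. of_bool (j = i) :: rat)"
      using assms(3) by (intro sum.cong) auto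
    also have "\<dots> = 1" using i(1) assms(1) by (simp add: of_bool_def)
    finally show ?thesis using i by auto
  qed auto
  then have "(\<Sum>i\<in>I. fps_const 1 * growth_series (A i)) = growth_series (\<Union>i\<in>I. A i)"
    using assms(2) by (intro growth_series_linear assms(1)) auto
  then show ?thesis by simp
qed

lemma growth_series_product:
  assumes A: "A \<subseteq> carrier W" and B: "B \<subseteq> carrier W"
    and inj: "inj_on (\<lambda>(a, b). a \<otimes> b) (A \<times> B)"
    and len: "\<And>a b. a \<in> A \<Longrightarrow> b \<in> B \<Longrightarrow> len (a \<otimes> b) = len a + len b"
  shows "growth_series ((\<lambda>(a, b). a \<otimes> b) ` (A \<times> B)) = growth_series A * growth_series B"
proof (rule fps_ext)
  fix n
  let ?m = "\<lambda>(a, b). a \<otimes> b"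
  let ?P = "\<lambda>i. {a \<in> A. len a = i} \<times> {b \<in> B. len b = n - i}"
  have "(\<Union>i\<in>{0..n}. ?P i) = {p \<in> A \<times> B. len (fst p) + len (snd p) = n}" by auto
  then have eq: "{x \<in> ?m ` (A \<times> B). len x = n} = ?m ` (\<Union>i\<in>{0..n}. ?P i)"
    using len by auto
  have "card {x \<in> ?m ` (A \<times> B). len x = n} = card (\<Union>i\<in>{0..n}. ?P i)"
    unfolding eq by (intro card_image inj_on_subset[OF inj]) auto
  also have "\<dots> = (\<Sum>i\<in>{0..n}. card (?P i))"
    by (intro card_UN_disjoint ballI finite_cartesian_product finite_len_eq A B) auto
  finally show "fps_nth (growth_series (?m ` (A \<times> B))) n = fps_nth (growth_series A * growth_series B) n"
    by (simp add: growth_series_nth fps_mult_nth card_cartesian_product)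
qed

lemma growth_series_rational_of_finite:
  assumes "finite A"
  shows "growth_series A \<in> rational_fps"
proof -
  have "growth_series A = (\<Sum>x\<in>A. fps_of_poly (monom 1 (len x)))"
  proof (rule fps_ext)
    fix n
    have "fps_nth (\<Sum>x\<in>A. fps_of_poly (monom (1::rat) (len x))) n = (\<Sum>x\<in>A. of_bool (len x = n))"
      by (simp add: fps_sum_nth of_bool_def)
    also have "\<dots> = of_nat (card (A \<inter> {x. len x = n}))"
      using assms by (simp add: of_bool_def sum.If_cases)
    also have "A \<inter> {x. len x = n} = {x \<in> A. len x = n}" by auto
    finally show "fps_nth (growth_series A) n = fps_nth (\<Sum>x\<in>A. fps_of_poly (monom 1 (len x))) n"
      by (simp add: growth_series_nth)
  qed
  then show ?thesis by (simp add: rational_fps_sum rational_fps_poly)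
qed

lemma growth_series_constant_term:
  assumes "A \<subseteq> carrier W"
  shows "fps_nth (growth_series A) 0 = of_bool (\<one> \<in> A)"
proof -
  have "{x \<in> A. len x = 0} = (if \<one> \<in> A then {\<one>} else {})"
    using assms len_eq_0_iff by auto
  then show ?thesis by (simp add: growth_series_nth)
qed

section \<open>Rationality for double coset representatives\<close>

lemma p_set_series_factor:
  assumes S': "S' \<subseteq> S" and J: "J \<subseteq> S'" and K: "K \<subseteq> S'" and Q: "Q \<subseteq> K"
  shows "growth_series (conj_reps S' J Q Q)
    = (\<Sum>Q'\<in>Pow K. growth_series (p_set W S S' Q' J K) * growth_series (p_set W S K Q Q' Q))"
proof -
  let ?m = "\<lambda>(y, z). y \<otimes> z"
  let ?A = "\<lambda>Q'. p_set W S S' Q' J K" and ?B = "\<lambda>Q'. p_set W S K Q Q' Q"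
  have KS: "K \<subseteq> S" and JS: "J \<subseteq> S" using assms by auto
  have A: "right_min K y" "Q' = {k \<in> K. y \<otimes> k \<otimes> inv y \<in> J}" if "y \<in> ?A Q'" for y Q'
    using that by (simp_all add: p_set_eq[OF S' JS KS] double_min_reps_iff[OF S'])
  have B: "z \<in> generate W K" if "z \<in> ?B Q'" for z Q'
    using that by (simp add: p_set_def double_min_reps_iff[OF KS])
  have Ac: "?A Q' \<subseteq> carrier W" for Q' by (rule p_set_carrier[OF S'])
  have Bc: "?B Q' \<subseteq> carrier W" for Q' by (rule p_set_carrier[OF KS])
  have "growth_series (conj_reps S' J Q Q) = (\<Sum>Q'\<in>Pow K. growth_series (?m ` (?A Q' \<times> ?B Q')))"
    unfolding conj_reps_factor[OF assms]
  proof (rule growth_series_UNION)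
    show "finite (Pow K)" using finite_subset[OF KS finite_S] by simp
    show "?m ` (?A Q' \<times> ?B Q') \<subseteq> carrier W" for Q'
      using Ac[of Q'] Bc[of Q'] by auto
    fix Q1 Q2 x
    assume "x \<in> ?m ` (?A Q1 \<times> ?B Q1)" "x \<in> ?m ` (?A Q2 \<times> ?B Q2)"
    then obtain y1 z1 y2 z2 where *: "y1 \<in> ?A Q1" "z1 \<in> ?B Q1" "y2 \<in> ?A Q2" "z2 \<in> ?B Q2"
      "y1 \<otimes> z1 = y2 \<otimes> z2" by auto
    have "y1 = y2"
      using parabolic_decomposition_unique[OF KS A(1)[OF *(1)] A(1)[OF *(3)] B[OF *(2)] B[OF *(4)] *(5)] ..
    then show "Q1 = Q2" using A(2)[OF *(1)] A(2)[OF *(3)] by simp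
  qed
  moreover have "growth_series (?m ` (?A Q' \<times> ?B Q')) = growth_series (?A Q') * growth_series (?B Q')" for Q'
  proof (rule growth_series_product[OF Ac Bc])
    show "inj_on ?m (?A Q' \<times> ?B Q')"
    proof (rule inj_onI, clarify)
      fix y z y' z'
      assume "y \<in> ?A Q'" "z \<in> ?B Q'" "y' \<in> ?A Q'" "z' \<in> ?B Q'" "y \<otimes> z = y' \<otimes> z'"
      then show "y = y' \<and> z = z'"
        using parabolic_decomposition_unique[OF KS A(1) A(1) B B] by blast
    qed
    show "len (y \<otimes> z) = len y + len z" if "y \<in> ?A Q'" "z \<in> ?B Q'" for y z
      using len_mult_right_min[OF KS A(1)[OF that(1)] B[OF that(2)]] .
  qed
  ultimately show ?thesis by simp
qed

text \<open>Any one element of the set bounds the length of all the others.\<close>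

lemma finite_all_descents:
  assumes S': "S' \<subseteq> S" and J: "J \<subseteq> S" and Q: "Q \<subseteq> S'"
  shows "finite {x \<in> conj_reps S' J Q Q. \<forall>s \<in> S' - Q. len (x \<otimes> s) \<le> len x}" (is "finite ?E")
proof (cases "?E = {}")
  case False
  then obtain x where x: "x \<in> ?E" by blast
  have E: "y \<in> generate W S' \<and> right_min Q y \<and> (\<forall>q\<in>Q. y \<otimes> q \<otimes> inv y \<in> S)" if "y \<in> ?E" for y
    using that J by (auto simp: conj_reps_def double_min_reps_iff[OF S'])
  have "len y \<le> len x" if "y \<in> ?E" for y
    by (rule len_le_of_all_descents[OF S' Q]) (use x E[OF x] E[OF that] in auto)
  then have "?E \<subseteq> {y \<in> carrier W. len y \<le> len x}"
    using E generate_carrier[OF S'] by blast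
  then show ?thesis by (rule finite_subset) (rule finite_len_le)
qed (metis finite.emptyI)

text \<open>For fixed \<open>x\<close> in \<open>\<^sup>JW\<^sub>S\<^sub>'\<^sup>Q\<close> with right ascents \<open>A\<close> in \<open>S'\<close>, the terms that count \<open>x\<close> are those with
  \<open>Q \<subseteq> K \<subseteq> A\<close>, and their signs cancel unless \<open>A = Q\<close>.\<close>

lemma conj_reps_alternating_sum:
  assumes S': "S' \<subseteq> S" and Q: "Q \<subseteq> S'"
  shows "(\<Sum>K | Q \<subseteq> K \<and> K \<subseteq> S'. fps_const ((- 1) ^ card (K - Q)) * growth_series (conj_reps S' J K Q))
    = growth_series {x \<in> conj_reps S' J Q Q. \<forall>s \<in> S' - Q. len (x \<otimes> s) \<le> len x}" (is "_ = growth_series ?E")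
proof (rule growth_series_linear)
  have finS': "finite S'" using S' finite_S by (rule finite_subset)
  show "finite {K. Q \<subseteq> K \<and> K \<subseteq> S'}" using finS' by (rule finite_subset[rotated, OF finite_Pow_iff[THEN iffD2]]) auto
  show "conj_reps S' J K Q \<subseteq> carrier W" for K by (rule conj_reps_carrier[OF S'])
  show "?E \<subseteq> carrier W" using conj_reps_carrier[OF S', of J Q Q] by blast
  fix x assume "x \<in> carrier W"
  let ?sum = "\<Sum>K | Q \<subseteq> K \<and> K \<subseteq> S'. (- 1) ^ card (K - Q) * of_bool (x \<in> conj_reps S' J K Q) :: rat"
  define A where "A = {s \<in> S'. len x < len (x \<otimes> s)}"
  show "?sum = of_bool (x \<in> ?E)"
  proof (cases "x \<in> conj_reps S' J Q Q")
    case True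
    then have QA: "Q \<subseteq> A" using Q by (auto simp: A_def conj_reps_def double_min_reps_iff[OF S'] right_min_def)
    have iff: "x \<in> conj_reps S' J K Q \<longleftrightarrow> K \<subseteq> A" if "K \<subseteq> S'" for K
      using True that by (auto simp: A_def conj_reps_def double_min_reps_iff[OF S'] right_min_def)
    have "?sum = (\<Sum>K | Q \<subseteq> K \<and> K \<subseteq> S'. if K \<subseteq> A then (- 1) ^ card (K - Q) else 0)"
      by (intro sum.cong) (auto simp: iff)
    also have "\<dots> = (\<Sum>K | Q \<subseteq> K \<and> K \<subseteq> A. (- 1) ^ card (K - Q))"
      using finS' by (intro sum.mono_neutral_cong_right) (auto simp: A_def)
    also have "\<dots> = of_bool (A = Q)"
      using finS' QA by (intro sum_subsets_between_sign) (auto simp: A_def)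
    also have "A = Q \<longleftrightarrow> (\<forall>s \<in> S' - Q. \<not> len x < len (x \<otimes> s))"
      using QA by (auto simp: A_def)
    also have "\<dots> \<longleftrightarrow> x \<in> ?E"
      using True by (simp add: not_less)
    finally show ?thesis .
  next
    case False
    have "x \<notin> conj_reps S' J K Q" if "Q \<subseteq> K" for K
      using False that by (auto simp: conj_reps_def double_min_reps_iff[OF S'] right_min_def)
    then show ?thesis using False by simp
  qed
qed

lemma right_min_self_eq_one:
  assumes "K \<subseteq> S" "right_min K x" "x \<in> generate W K"
  shows "x = \<one>"
proof -
  have xc: "x \<in> carrier W" using assms(2) by (rule right_min_carrier)
  have "len (x \<otimes> inv x) = len x + len (inv x)"
    by (rule len_mult_right_min[OF assms(1,2) generate_inv[OF assms(1,3)]])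
  then show ?thesis using xc len_eq_0_iff[OF xc] by simp
qed

lemma double_min_reps_self: "S' \<subseteq> S \<Longrightarrow> double_min_reps W S S' J S' \<subseteq> {\<one>}"
  using right_min_self_eq_one by (auto simp: double_min_reps_iff)

lemma conj_reps_series_sum:
  assumes "S' \<subseteq> S" "J \<subseteq> S" "K \<subseteq> S" "Q \<subseteq> K"
  shows "growth_series (conj_reps S' J K Q)
    = (\<Sum>Q' | Q \<subseteq> Q' \<and> Q' \<subseteq> K. growth_series (p_set W S S' Q' J K))"
  unfolding conj_reps_eq_Union[OF assms]
proof (rule growth_series_UNION)
  show "finite {Q'. Q \<subseteq> Q' \<and> Q' \<subseteq> K}"
    using finite_subset[OF assms(3) finite_S] by simp
  show "p_set W S S' Q' J K \<subseteq> carrier W" for Q' by (rule p_set_carrier[OF assms(1)])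
  show "Q1 = Q2" if "x \<in> p_set W S S' Q1 J K" "x \<in> p_set W S S' Q2 J K" for Q1 Q2 x
    using that by (simp add: p_set_eq[OF assms(1-3)])
qed

lemma sum_fps_const: "(\<Sum>i\<in>I. fps_const (c i)) = fps_const (\<Sum>i\<in>I. c i :: rat)"
  by (induction I rule: infinite_finite_induct) auto

text \<open>Induction on the size of \<open>S'\<close>. The unknowns of the linear system are the series \<open>v(Q', K')\<close> of
  \<open>p\<^sup>S\<^sup>'\<^sub>Q\<^sub>'\<^sub>,\<^sub>J\<^sub>,\<^sub>K\<^sub>'\<close> with \<open>K' \<noteq> S'\<close>. The remaining sets with \<open>K' = S'\<close> contain at most the identity.\<close>

theorem p_set_rational:
  assumes "S' \<subseteq> S" "J \<subseteq> S'" "K \<subseteq> S'"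
  shows "growth_series (p_set W S S' Q J K) \<in> rational_fps"
  using assms
proof (induction "card S'" arbitrary: S' J K Q rule: less_induct)
  case less
  note S' = \<open>S' \<subseteq> S\<close> and J = \<open>J \<subseteq> S'\<close>
  have JS: "J \<subseteq> S" using S' J by blast
  have finS': "finite S'" using S' finite_S by (rule finite_subset)
  define v where "v = (\<lambda>(Q', K'). growth_series (p_set W S S' Q' J K'))"
  define F where "F K' Q' = growth_series (conj_reps S' J K' Q')" for K' Q'
  define I where "I = {(Q', K'). Q' \<subseteq> K' \<and> K' \<subset> S'}"
  have "I \<subseteq> Pow S' \<times> Pow S'" by (auto simp: I_def)
  then have finI: "finite I" by (rule finite_subset) (use finS' in simp)
  \<comment> \<open>Subtracting the constant term of the factor that belongs to \<open>W\<^sub>K\<^sub>'\<close> leaves only small coefficients.\<close>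
  have F_diff: "F Q Q - F K' Q \<in> small_combinations I v" if "Q \<subseteq> K'" "K' \<subset> S'" for Q K'
  proof -
    have K': "K' \<subseteq> S'" "K' \<subseteq> S" "finite K'" using that S' finS' finite_subset by blast+
    have QS: "Q \<subseteq> S" using that(1) K'(2) by blast
    let ?a = "\<lambda>Q'. growth_series (p_set W S K' Q Q' Q)"
    have "F K' Q = (\<Sum>Q'\<in>Pow K'. of_bool (Q \<subseteq> Q') * v (Q', K'))"
      unfolding F_def v_def conj_reps_series_sum[OF S' JS K'(2) that(1)]
      using K'(3) by (intro sum.mono_neutral_cong_left) auto
    then have eq: "F Q Q - F K' Q = (\<Sum>Q'\<in>Pow K'. (?a Q' - of_bool (Q \<subseteq> Q')) * v (Q', K'))"
      unfolding F_def v_def p_set_series_factor[OF S' J K'(1) that(1)]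
      by (simp add: sum_subtractf algebra_simps)
    have "(?a Q' - of_bool (Q \<subseteq> Q')) * v (Q', K') \<in> small_combinations I v" if Q': "Q' \<in> Pow K'" for Q'
    proof (rule small_multiple_small_combination[OF finI])
      show "(Q', K') \<in> I" using Q' \<open>K' \<subset> S'\<close> by (simp add: I_def)
      have "?a Q' \<in> rational_fps"
        using less.hyps[of K' Q' Q Q] psubset_card_mono[OF finS' \<open>K' \<subset> S'\<close>] K'(2) Q' \<open>Q \<subseteq> K'\<close> by simp
      then show "?a Q' - of_bool (Q \<subseteq> Q') \<in> rational_fps" by (cases "Q \<subseteq> Q'") (auto intro: rational_fps_diff)
      have Q'S: "Q' \<subseteq> S" using Q' K'(2) by blast
      have "\<one> \<in> p_set W S K' Q Q' Q \<longleftrightarrow> Q \<subseteq> Q'"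
        unfolding p_set_diagonal[OF K'(2) Q'S QS]
        using Q'S QS by (auto simp: conj_reps_def double_min_reps_iff[OF K'(2)] right_min_def
            generate.one subset_iff)
      then show "fps_nth (?a Q' - of_bool (Q \<subseteq> Q')) 0 = 0"
        using growth_series_constant_term[OF p_set_carrier[OF K'(2)]] by simp
    qed
    then show ?thesis unfolding eq by (rule small_combinations_sum)
  qed
  \<comment> \<open>In the alternating sum every \<open>F K Q\<close> with \<open>K \<noteq> S'\<close> may be replaced by \<open>F Q Q\<close>; the total sign is then \<open>\<plusminus>1\<close>.\<close>
  have F_diag: "F Q Q \<in> small_combinations I v" if "Q \<subset> S'" for Q
  proof -
    let ?P = "{K. Q \<subseteq> K \<and> K \<subset> S'}"
    let ?c = "\<lambda>K. fps_const ((- 1) ^ card (K - Q) :: rat)"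
    have c: "?c K \<in> rational_fps" for K using rational_fps_poly[of "[:(- 1) ^ card (K - Q):]"]
      by (simp add: fps_of_poly_const)
    have finP: "finite ?P" by (rule finite_subset[of _ "Pow S'"]) (use finS' in auto)
    have split: "{K. Q \<subseteq> K \<and> K \<subseteq> S'} = insert S' ?P" using that by auto
    have "(\<Sum>K\<in>?P. ?c K * F K Q) + ?c S' * F S' Q \<in> rational_fps"
      using conj_reps_alternating_sum[OF S' psubset_imp_subset[OF that], of J] finP
        growth_series_rational_of_finite[OF finite_all_descents[OF S' JS psubset_imp_subset[OF that]]]
      unfolding split by (simp add: F_def add.commute)
    moreover have "F S' Q \<in> rational_fps" unfolding F_def
      by (rule growth_series_rational_of_finite, rule finite_subset[of _ "{\<one>}"])
         (use double_min_reps_self[OF S'] in \<open>auto simp: conj_reps_def\<close>)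
    ultimately have "((\<Sum>K\<in>?P. ?c K * F K Q) + ?c S' * F S' Q) - ?c S' * F S' Q \<in> rational_fps"
      by (intro rational_fps_diff rational_fps_mult c)
    then have "(\<Sum>K\<in>?P. ?c K * F K Q) \<in> small_combinations I v"
      by (intro rational_small_combination) simp
    moreover have "(\<Sum>K\<in>?P. ?c K * (F Q Q - F K Q)) \<in> small_combinations I v"
      by (intro small_combinations_sum small_combinations_scale[OF c] F_diff) auto
    ultimately have "(\<Sum>K\<in>?P. ?c K * F K Q) + (\<Sum>K\<in>?P. ?c K * (F Q Q - F K Q)) \<in> small_combinations I v"
      by (rule small_combinations_add)
    also have "(\<Sum>K\<in>?P. ?c K * F K Q) + (\<Sum>K\<in>?P. ?c K * (F Q Q - F K Q)) = (\<Sum>K\<in>?P. ?c K) * F Q Q"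
      unfolding sum.distrib[symmetric] sum_distrib_right by (simp add: algebra_simps)
    also have "(\<Sum>K\<in>?P. ?c K) = - ?c S'"
    proof -
      have "(\<Sum>K\<in>insert S' ?P. (- 1) ^ card (K - Q)) = (0 :: rat)"
        using sum_subsets_between_sign[OF finS' psubset_imp_subset[OF that], where 'a = rat] that
        unfolding split by auto
      then have "(\<Sum>K\<in>?P. (- 1) ^ card (K - Q)) = - ((- 1) ^ card (S' - Q) :: rat)"
        using finP by (simp add: eq_neg_iff_add_eq_0 add.commute)
      then show ?thesis by (simp add: sum_fps_const)
    qed
    finally have "- ?c S' * (- ?c S' * F Q Q) \<in> small_combinations I v"
      by (rule small_combinations_scale[OF rational_fps_uminus[OF c]])
    also have "- ?c S' * (- ?c S' * F Q Q) = F Q Q"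
      by (simp add: mult.assoc[symmetric] power_mult_distrib[symmetric])
    finally show ?thesis .
  qed
  \<comment> \<open>Moebius inversion on the subsets of \<open>K'\<close> containing \<open>Q\<close>, from the largest downwards.\<close>
  have v_small: "v (Q, K') \<in> small_combinations I v" if "Q \<subseteq> K'" "K' \<subset> S'" for Q K'
    using that(1)
  proof (induction "card (K' - Q)" arbitrary: Q rule: less_induct)
    case (less Q)
    have K': "K' \<subseteq> S" "finite K'" using that S' finS' finite_subset by blast+
    have "F Q Q - (F Q Q - F K' Q) \<in> small_combinations I v"
      using less.prems that(2) by (intro small_combinations_diff F_diag F_diff) auto
    then have "F K' Q \<in> small_combinations I v" by simp
    moreover have "(\<Sum>Q' | Q \<subset> Q' \<and> Q' \<subseteq> K'. v (Q', K')) \<in> small_combinations I v"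
      using K'(2) by (intro small_combinations_sum less.hyps psubset_card_mono) auto
    moreover have "F K' Q = v (Q, K') + (\<Sum>Q' | Q \<subset> Q' \<and> Q' \<subseteq> K'. v (Q', K'))"
    proof -
      have "{Q'. Q \<subseteq> Q' \<and> Q' \<subseteq> K'} = insert Q {Q'. Q \<subset> Q' \<and> Q' \<subseteq> K'}" using less.prems by auto
      then show ?thesis
        using K'(2) unfolding F_def v_def conj_reps_series_sum[OF S' JS K'(1) less.prems] by simp
    qed
    ultimately show ?case using small_combinations_diff by fastforce
  qed
  have KS: "K \<subseteq> S" using less.prems by blast
  consider "K = S'" | "\<not> Q \<subseteq> K" | "Q \<subseteq> K" "K \<subset> S'" using less.prems(3) by blast
  then show ?case
  proof cases
    case 1
    then have "p_set W S S' Q J K \<subseteq> {\<one>}" using double_min_reps_self[OF S', of J] by (auto simp: p_set_def)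
    then have "finite (p_set W S S' Q J K)" by (rule finite_subset) simp
    then show ?thesis by (rule growth_series_rational_of_finite)
  next
    case 2
    then have "p_set W S S' Q J K = {}" by (auto simp: p_set_eq[OF S' JS KS])
    then show ?thesis by (simp add: growth_series_rational_of_finite)
  next
    case 3
    have "v (Q, K) \<in> rational_fps"
      using 3 v_small by (intro rational_of_small_combinations[OF finI, of v]) (auto simp: I_def)
    then show ?thesis by (simp add: v_def)
  qed
qed

section \<open>Rationality for conjugators\<close>

lemma conj_inj_on: "x \<in> carrier W \<Longrightarrow> inj_on (\<lambda>s. x \<otimes> s \<otimes> inv x) (carrier W)"
  by (auto simp: inj_on_def mult_left_eq_iff mult_right_eq_iff)

text \<open>If \<open>x = y u\<close> conjugates \<open>L\<close> into \<open>S\<close>, then \<open>u\<close> conjugates \<open>L\<close> into \<open>L\<close>, and onto \<open>L\<close> because \<open>L\<close> is finite.\<close>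

lemma conjugators_eq_product:
  assumes S': "S' \<subseteq> S" and L: "L \<subseteq> S'" and M: "M \<subseteq> S"
  shows "{x \<in> generate W S'. (\<lambda>s. x \<otimes> s \<otimes> inv x) ` L = M}
    = (\<lambda>(y, u). y \<otimes> u) ` ({y \<in> generate W S'. right_min L y \<and> (\<lambda>s. y \<otimes> s \<otimes> inv y) ` L = M}
        \<times> {u \<in> generate W L. (\<lambda>s. u \<otimes> s \<otimes> inv u) ` L = L})" (is "?N = ?m ` (?A \<times> ?U)")
proof
  have LS: "L \<subseteq> S" using L S' by blast
  have finL: "finite L" using LS finite_S by (rule finite_subset)
  have pL: "generate W L \<subseteq> generate W S'" by (rule mono_generate[OF L])
  have conj_image: "(\<lambda>s. (y \<otimes> u) \<otimes> s \<otimes> inv (y \<otimes> u)) ` L = (\<lambda>s. y \<otimes> s \<otimes> inv y) ` (\<lambda>s. u \<otimes> s \<otimes> inv u) ` L"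
    if "y \<in> carrier W" "u \<in> carrier W" for y u
    unfolding image_image using that LS by (intro image_cong HOL.refl conj_mult) auto
  show "?N \<subseteq> ?m ` (?A \<times> ?U)"
  proof
    fix x assume "x \<in> ?N"
    then have x: "x \<in> generate W S'" "(\<lambda>s. x \<otimes> s \<otimes> inv x) ` L = M" by auto
    obtain y u where yu: "right_min L y" "u \<in> generate W L" "x = y \<otimes> u"
      by (rule parabolic_decomposition[OF LS generate_carrier[OF S' x(1)]])
    have c: "y \<in> carrier W" "u \<in> carrier W"
      using yu right_min_carrier generate_carrier[OF LS] by auto
    have "y = x \<otimes> inv u" using yu(3) c by (simp add: m_assoc)
    then have y: "y \<in> generate W S'"
      using x(1) pL generate_inv[OF LS yu(2)] by (auto intro: generate.eng)
    have "(\<lambda>s. u \<otimes> s \<otimes> inv u) ` L \<subseteq> L"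
    proof safe
      fix q assume "q \<in> L"
      then have "x \<otimes> q \<otimes> inv x \<in> S" using x(2) M by blast
      then show "u \<otimes> q \<otimes> inv u \<in> L" unfolding yu(3) by (rule conj_in_parabolic[OF LS yu(1,2) \<open>q \<in> L\<close>])
    qed
    moreover have "inj_on (\<lambda>s. u \<otimes> s \<otimes> inv u) L"
      using LS S_carrier by (intro inj_on_subset[OF conj_inj_on[OF c(2)]]) auto
    ultimately have u: "(\<lambda>s. u \<otimes> s \<otimes> inv u) ` L = L" using finL endo_inj_surj by blast
    have "(\<lambda>s. y \<otimes> s \<otimes> inv y) ` L = M"
      using x(2) conj_image[OF c] u yu(3) by simp
    then show "x \<in> ?m ` (?A \<times> ?U)" using y u yu by force
  qed
  show "?m ` (?A \<times> ?U) \<subseteq> ?N"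
  proof
    fix x assume "x \<in> ?m ` (?A \<times> ?U)"
    then obtain y u where yu: "x = y \<otimes> u" "y \<in> ?A" "u \<in> ?U" by auto
    then have "(\<lambda>s. x \<otimes> s \<otimes> inv x) ` L = M"
      using conj_image[of y u] right_min_carrier generate_carrier[OF LS] by auto
    then show "x \<in> ?N" using yu pL by (auto intro: generate.eng)
  qed
qed

text \<open>For \<open>y \<in> W\<^sup>L\<close> conjugating \<open>L\<close> onto \<open>M\<close>, left ascents in \<open>M\<close> are automatic, as \<open>m y = y q\<close> with \<open>q \<in> L\<close>. The
  condition of \<open>p\<^sup>S\<^sup>'\<^sub>L\<^sub>,\<^sub>M\<^sub>,\<^sub>L\<close> only says that \<open>y\<close> conjugates \<open>L\<close> into \<open>M\<close>; equal cardinality makes this onto.\<close>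

lemma min_conjugators_eq_p_set:
  assumes S': "S' \<subseteq> S" and L: "L \<subseteq> S'" and M: "M \<subseteq> S'" and card: "card L = card M"
  shows "{y \<in> generate W S'. right_min L y \<and> (\<lambda>s. y \<otimes> s \<otimes> inv y) ` L = M} = p_set W S S' L M L"
proof -
  have LS: "L \<subseteq> S" and MS: "M \<subseteq> S" using L M S' by blast+
  have finM: "finite M" using MS finite_S by (rule finite_subset)
  have "(\<lambda>s. y \<otimes> s \<otimes> inv y) ` L = M \<longleftrightarrow>
      (\<forall>m\<in>M. len y < len (m \<otimes> y)) \<and> (\<forall>q\<in>L. y \<otimes> q \<otimes> inv y \<in> M)" (is "?l \<longleftrightarrow> ?r")
    if y: "right_min L y" for y
  proof
    assume l: ?l
    have yc: "y \<in> carrier W" using y by (rule right_min_carrier)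
    have "len y < len (m \<otimes> y)" if m: "m \<in> M" for m
    proof -
      obtain q where q: "q \<in> L" "m = y \<otimes> q \<otimes> inv y" using l m by blast
      have "m \<otimes> y = y \<otimes> q" using q yc subsetD[OF LS q(1)] by (simp add: m_assoc)
      then show ?thesis using y q(1) by (simp add: right_min_def)
    qed
    then show ?r using l by blast
  next
    assume r: ?r
    have "inj_on (\<lambda>s. y \<otimes> s \<otimes> inv y) L"
      using LS S_carrier by (intro inj_on_subset[OF conj_inj_on[OF right_min_carrier[OF y]]]) auto
    then have "card ((\<lambda>s. y \<otimes> s \<otimes> inv y) ` L) = card M" using card by (simp add: card_image)
    moreover have "(\<lambda>s. y \<otimes> s \<otimes> inv y) ` L \<subseteq> M" using r by blast
    ultimately show ?l using finM by (intro card_subset_eq)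
  qed
  then show ?thesis
    unfolding p_set_diagonal[OF S' MS LS] by (auto simp: conj_reps_def double_min_reps_iff[OF S'])
qed

theorem conjugators_rational:
  assumes S': "S' \<subseteq> S" and L: "L \<subseteq> S'" and M: "M \<subseteq> S'" and fin: "finite (generate W L)"
  shows "growth_series {x \<in> generate W S'. (\<lambda>s. x \<otimes> s \<otimes> inv x) ` L = M} \<in> rational_fps"
proof -
  have LS: "L \<subseteq> S" and MS: "M \<subseteq> S" using L M S' by blast+
  let ?A = "{y \<in> generate W S'. right_min L y \<and> (\<lambda>s. y \<otimes> s \<otimes> inv y) ` L = M}"
  let ?U = "{u \<in> generate W L. (\<lambda>s. u \<otimes> s \<otimes> inv u) ` L = L}"
  have Ac: "?A \<subseteq> carrier W" using generate_carrier[OF S'] by blast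
  have Uc: "?U \<subseteq> carrier W" using generate_carrier[OF LS] by blast
  have "growth_series ?A \<in> rational_fps"
  proof (cases "?A = {}")
    case False
    then obtain y where y: "right_min L y" "(\<lambda>s. y \<otimes> s \<otimes> inv y) ` L = M" by blast
    have "inj_on (\<lambda>s. y \<otimes> s \<otimes> inv y) L"
      using LS S_carrier by (intro inj_on_subset[OF conj_inj_on[OF right_min_carrier[OF y(1)]]]) auto
    then have "card L = card M" using y(2) card_image by force
    then show ?thesis
      using p_set_rational[OF S' M L] by (simp add: min_conjugators_eq_p_set[OF S' L M])
  next
    case True
    show ?thesis unfolding True by (rule growth_series_rational_of_finite) simp
  qed
  moreover have "growth_series ?U \<in> rational_fps"
    by (rule growth_series_rational_of_finite, rule finite_subset[OF _ fin]) auto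
  moreover have "growth_series ((\<lambda>(y, u). y \<otimes> u) ` (?A \<times> ?U)) = growth_series ?A * growth_series ?U"
  proof (rule growth_series_product[OF Ac Uc])
    show "inj_on (\<lambda>(y, u). y \<otimes> u) (?A \<times> ?U)"
    proof (rule inj_onI, clarify)
      fix y u y' u'
      assume "right_min L y" "right_min L y'" "u \<in> generate W L" "u' \<in> generate W L" "y \<otimes> u = y' \<otimes> u'"
      then show "y = y' \<and> u = u'" by (rule parabolic_decomposition_unique[OF LS])
    qed
    show "len (y \<otimes> u) = len y + len u" if "y \<in> ?A" "u \<in> ?U" for y u
      using that by (intro len_mult_right_min[OF LS]) auto
  qed
  ultimately show ?thesis unfolding conjugators_eq_product[OF S' L MS] by auto
qed

end

theorem theorem1:
  fixes W :: "('a, 'b) monoid_scheme" and S :: "'a set"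
  assumes "coxeter_system W S" and "finite S"
  shows "(\<forall>S' Q J K. S' \<subseteq> S \<and> Q \<subseteq> S' \<and> J \<subseteq> S' \<and> K \<subseteq> S' \<longrightarrow>
            rational_series (poincare_series W S (p_set W S S' Q J K))) \<longleftrightarrow>
         (\<forall>S' L M. S' \<subseteq> S \<and> L \<subseteq> S' \<and> M \<subseteq> S' \<and> finite (generate W L) \<longrightarrow>
            rational_series (poincare_series W S
              {x \<in> generate W S'. (\<lambda>s. x \<otimes>\<^bsub>W\<^esub> s \<otimes>\<^bsub>W\<^esub> inv\<^bsub>W\<^esub> x) ` L = M}))"
proof -
  interpret group W using assms(1) by (simp add: coxeter_system_def)
  interpret coxeter_finite_rank W S by unfold_locales (fact assms)+
  show ?thesis
    using p_set_rational conjugators_rational by (simp add: rational_series_iff)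
qed

end
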